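(* Let $\mathbf{g}$ be a finite simple graph with vertex set $N$, and let $\mathfrak{G}\subseteq \mathrm{Aut}(\mathbf{g})$ be a subgroup of its automorphism group. Then: \begin{enumerate} \item Write $\chi(\mathbf{g},\mathfrak{G},\mathbf{x}) = \sum_{S\subseteq[|N|-1]} c_{\mathfrak{G},S}\, M_{\alpha(S)}$ with $c_{\mathfrak{G},S}$ complex-valued class functions on $\mathfrak{G}$. Then each $c_{\mathfrak{G},S}$ is the character of a representation of $\mathfrak{G}$, and for all $S\subseteq T\subseteq[|N|-1]$ we have $c_{\mathfrak{G},S}\leq_{\mathfrak{G}} c_{\mathfrak{G},T}$. \item Let $\chi^O(\mathbf{g},\mathfrak{G},x)$ be the orbital chromatic polynomial and write $\chi^O(\mathbf{g},\mathfrak{G},x)=\sum_{i=0}^{|N|} f_i\binom{x}{i}$. Then (a) for $0\le i\le \frac{|N|-1}{2}$, $f_i\le f_{i+1}$; (b) for $0\le i\le \frac{|N|}{2}$, $f_i\le f_{|N|-i}$; (c) for all $i$, $(|N|-i)f_i\le i f_{i+1}$. \end{enumerate}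
   Context: $\mathbb{N}=\{0,1,2,\dots\}$, $[x]=\{1,\dots,x\}$, and $\mathbf{x}=x_1,x_2,\dots$ are commuting indeterminates. A proper coloring of $\mathbf{g}$ is a function $f:N\to\mathbb{N}$ with $f(u)\neq f(v)$ whenever $uv$ is an edge. $\mathfrak{G}$ acts on proper colorings by $\mathfrak{g}f=f\circ\mathfrak{g}^{-1}$. For $\mathfrak{g}\in\mathfrak{G}$, $\chi(\mathbf{g},\mathfrak{G},\mathbf{x};\mathfrak{g})=\sum_{f}\prod_{v\in N}x_{f(v)}$, the sum over proper colorings $f$ with $\mathfrak{g}f=f$; this is a quasisymmetric function, and as a function of $\mathfrak{g}$ it is constant on conjugacy classes. For an integer composition $\alpha=(\alpha_1,\dots,\alpha_k)$, $M_\alpha=\sum_{i_1<\cdots<i_k}\prod_j x_{i_j}^{\alpha_j}$ is the monomial quasisymmetric function. For $S=\{s_1<\dots<s_k\}\subseteq[|N|-1]$, $\alpha(S)=(s_1,s_2-s_1,\dots,s_k-s_{k-1},|N|-s_k)$. For two characters $\rho_V,\rho_W$ of $\mathfrak{G}$-modules $V,W$, $\rho_V\le_{\mathfrak{G}}\rho_W$ means $V$ is isomorphic to a submodule of $W$ (equivalently $\rho_W-\rho_V$ is a nonnegative integer combination of irreducible characters). The orbital chromatic polynomial $\chi^O(\mathbf{g},\mathfrak{G},x)$ is the number of $\mathfrak{G}$-orbits of proper colorings $f$ with $f(N)\subseteq[x]$; it is a polynomial in $x$, and $(f_0,\dots,f_{|N|})$ are its coefficients in the basis $\binom{x}{i}$.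 *)

theory Defs
  imports
    "Jordan_Normal_Form.VS_Connect"
    "HOL-Algebra.Group_Action"
    "HOL-Combinatorics.Permutations"
    "HOL-Library.Poly_Mapping"
begin

section \<open>Representations and characters over the complex numbers\<close>

text \<open>
  A \<open>G\<close>-module of dimension \<open>n\<close> is \<open>\<complex>\<^sup>n\<close> with \<open>G\<close> acting through a homomorphism to
  \<open>GL\<^sub>n(\<complex>)\<close>, the unit group of the matrix ring. The case \<open>n = 0\<close> is allowed, so the
  zero function is a character.
\<close>

definition representation :: "('g, 'b) monoid_scheme \<Rightarrow> nat \<Rightarrow> ('g \<Rightarrow> complex mat) \<Rightarrow> bool" where
  "representation G n \<rho> \<longleftrightarrow> \<rho> \<in> hom G (units_of (ring_mat TYPE(complex) n ()))"

definition rep_character :: "nat \<Rightarrow> ('g \<Rightarrow> complex mat) \<Rightarrow> 'g \<Rightarrow> complex" where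
  "rep_character n \<rho> g = (\<Sum>i<n. \<rho> g $$ (i, i))"

definition has_character ::
    "('g, 'b) monoid_scheme \<Rightarrow> nat \<Rightarrow> ('g \<Rightarrow> complex mat) \<Rightarrow> ('g \<Rightarrow> complex) \<Rightarrow> bool" where
  "has_character G n \<rho> \<chi> \<longleftrightarrow>
     representation G n \<rho> \<and> (\<forall>g\<in>carrier G. \<chi> g = rep_character n \<rho> g)"

definition is_character :: "('g, 'b) monoid_scheme \<Rightarrow> ('g \<Rightarrow> complex) \<Rightarrow> bool" where
  "is_character G \<chi> \<longleftrightarrow> (\<exists>n \<rho>. has_character G n \<rho> \<chi>)"

definition class_function :: "('g, 'b) monoid_scheme \<Rightarrow> ('g \<Rightarrow> complex) \<Rightarrow> bool" where
  "class_function G \<chi> \<longleftrightarrow>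
     (\<forall>g\<in>carrier G. \<forall>h\<in>carrier G. \<chi> (h \<otimes>\<^bsub>G\<^esub> g \<otimes>\<^bsub>G\<^esub> inv\<^bsub>G\<^esub> h) = \<chi> g)"

definition subrepresentation ::
    "('g, 'b) monoid_scheme \<Rightarrow> nat \<Rightarrow> ('g \<Rightarrow> complex mat) \<Rightarrow> complex vec set \<Rightarrow> bool" where
  "subrepresentation G m \<sigma> U \<longleftrightarrow>
     VectorSpace.subspace class_ring U (module_vec TYPE(complex) m) \<and>
     (\<forall>g\<in>carrier G. \<forall>u\<in>U. \<sigma> g *\<^sub>v u \<in> U)"

definition isomorphic_to_submodule ::
    "('g, 'b) monoid_scheme \<Rightarrow> nat \<Rightarrow> ('g \<Rightarrow> complex mat) \<Rightarrow> nat \<Rightarrow> ('g \<Rightarrow> complex mat) \<Rightarrow> bool" where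
  "isomorphic_to_submodule G n \<rho> m \<sigma> \<longleftrightarrow>
     (\<exists>U \<phi>. subrepresentation G m \<sigma> U \<and>
        \<phi> \<in> LinearCombinations.module_hom class_ring
              (module_vec TYPE(complex) n) ((module_vec TYPE(complex) m)\<lparr>carrier := U\<rparr>) \<and>
        bij_betw \<phi> (carrier_vec n) U \<and>
        (\<forall>g\<in>carrier G. \<forall>v\<in>carrier_vec n. \<phi> (\<rho> g *\<^sub>v v) = \<sigma> g *\<^sub>v \<phi> v))"

text \<open>
  The relation \<open>\<chi> \<le>\<^sub>G \<psi>\<close>. For a finite group \<open>G\<close> complex representations are
  determined up to isomorphism by their characters, so the choice of the modules affording
  \<open>\<chi>\<close> and \<open>\<psi>\<close> is immaterial.
\<close>

definition char_le :: "('g, 'b) monoid_scheme \<Rightarrow> ('g \<Rightarrow> complex) \<Rightarrow> ('g \<Rightarrow> complex) \<Rightarrow> bool" where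
  "char_le G \<chi> \<psi> \<longleftrightarrow>
     (\<exists>n \<rho> m \<sigma>. has_character G n \<rho> \<chi> \<and> has_character G m \<sigma> \<psi> \<and>
        isomorphic_to_submodule G n \<rho> m \<sigma>)"


section \<open>Graphs, automorphisms and proper colorings\<close>

definition simple_graph :: "'a set \<Rightarrow> 'a set set \<Rightarrow> bool" where
  "simple_graph N E \<longleftrightarrow> finite N \<and> (\<forall>e\<in>E. e \<subseteq> N \<and> card e = 2)"

definition aut_group :: "'a set \<Rightarrow> 'a set set \<Rightarrow> ('a \<Rightarrow> 'a) monoid" where
  "aut_group N E =
     \<lparr>carrier = {p. p permutes N \<and> (\<forall>u\<in>N. \<forall>v\<in>N. {p u, p v} \<in> E \<longleftrightarrow> {u, v} \<in> E)},
      mult = (\<circ>), one = id\<rparr>"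

text \<open>
  Colorings are extensional (undefined outside \<open>N\<close>), so that distinct elements of the set
  are distinct as functions on \<open>N\<close>. Permutations of \<open>N\<close> are the identity outside \<open>N\<close>,
  hence \<open>f \<circ> g\<^sup>-\<^sup>1\<close> is again extensional.
\<close>

definition proper_colorings :: "'a set \<Rightarrow> 'a set set \<Rightarrow> ('a \<Rightarrow> nat) set" where
  "proper_colorings N E =
     {f \<in> N \<rightarrow>\<^sub>E UNIV. \<forall>u\<in>N. \<forall>v\<in>N. {u, v} \<in> E \<longrightarrow> f u \<noteq> f v}"

definition coloring_action :: "('a \<Rightarrow> 'a) \<Rightarrow> ('a \<Rightarrow> nat) \<Rightarrow> ('a \<Rightarrow> nat)" where
  "coloring_action g f = f \<circ> inv_into UNIV g"


section \<open>Quasisymmetric functions\<close>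

text \<open>
  A formal power series in commuting indeterminates indexed by the natural numbers (one for each
  color, including \<open>0\<close>) is given by its coefficients; a monomial is a finitely supported
  exponent function.
\<close>

type_synonym power_series = "(nat \<Rightarrow>\<^sub>0 nat) \<Rightarrow> complex"

text \<open>
  The formal sum of the monomials \<open>t i\<close> for \<open>i \<in> A\<close>, where each monomial must occur for only
  finitely many \<open>i\<close>.
\<close>

definition sum_of_monomials :: "('i \<Rightarrow> (nat \<Rightarrow>\<^sub>0 nat)) \<Rightarrow> 'i set \<Rightarrow> power_series" where
  "sum_of_monomials t A = (\<lambda>m. of_nat (card {i \<in> A. t i = m}))"

definition chromatic_qsym ::
    "'a set \<Rightarrow> 'a set set \<Rightarrow> ('a \<Rightarrow> 'a) \<Rightarrow> power_series" where
  "chromatic_qsym N E g =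
     sum_of_monomials (\<lambda>f. \<Sum>v\<in>N. Poly_Mapping.single (f v) 1)
       {f \<in> proper_colorings N E. coloring_action g f = f}"

definition monomial_qsym :: "nat list \<Rightarrow> power_series" where
  "monomial_qsym \<alpha> =
     sum_of_monomials (\<lambda>ks. \<Sum>j<length \<alpha>. Poly_Mapping.single (ks ! j) (\<alpha> ! j))
       {ks. length ks = length \<alpha> \<and> sorted_wrt (<) ks}"

text \<open>
  For \<open>n = 0\<close> the only composition is the empty one; the general formula would
  produce the part \<open>0\<close>.
\<close>

definition composition_of_set :: "nat \<Rightarrow> nat set \<Rightarrow> nat list" where
  "composition_of_set n S =
     (if n = 0 then []
      else let s = sorted_list_of_set S in map2 (-) (s @ [n]) (0 # s))"

definition qsym_expansion ::
    "'a set \<Rightarrow> 'a set set \<Rightarrow> ('a \<Rightarrow> 'a) set \<Rightarrow> (nat set \<Rightarrow> ('a \<Rightarrow> 'a) \<Rightarrow> complex) \<Rightarrow> bool" where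
  "qsym_expansion N E H c \<longleftrightarrow>
     (\<forall>g\<in>H. chromatic_qsym N E g =
        (\<lambda>m. \<Sum>S\<in>Pow {1..card N - 1}. c S g * monomial_qsym (composition_of_set (card N) S) m))"


section \<open>The orbital chromatic polynomial\<close>

definition orbital_count :: "'a set \<Rightarrow> 'a set set \<Rightarrow> ('a \<Rightarrow> 'a) set \<Rightarrow> nat \<Rightarrow> nat" where
  "orbital_count N E H x =
     card (orbits ((aut_group N E)\<lparr>carrier := H\<rparr>)
       {f \<in> proper_colorings N E. f ` N \<subseteq> {1..x}} coloring_action)"

definition orbital_chromatic_poly ::
    "'a set \<Rightarrow> 'a set set \<Rightarrow> ('a \<Rightarrow> 'a) set \<Rightarrow> real poly" where
  "orbital_chromatic_poly N E H =
     (THE p. \<forall>x::nat. poly p (real x) = real (orbital_count N E H x))"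

definition binomial_expansion :: "nat \<Rightarrow> real poly \<Rightarrow> (nat \<Rightarrow> real) \<Rightarrow> bool" where
  "binomial_expansion n p f \<longleftrightarrow> (\<forall>x. poly p x = (\<Sum>i\<le>n. f i * (x gchoose i)))"

end

theory Submission
  imports Defs
begin

text \<open>
  The coefficient of the monomial quasisymmetric function of \<open>S\<close> is the permutation character of
  the group on the set of ordered partitions of the vertices into stable blocks whose sizes are the
  parts of \<open>\<alpha>(S)\<close>. For \<open>S \<subseteq> T\<close>, merging consecutive blocks is an equivariant partial map from the
  partitions of type \<open>T\<close> to those of type \<open>S\<close>; it is onto, because a stable block can be split
  arbitrarily. Pulling functions back along it gives the inclusion of modules, and passing to
  orbits shows that the number \<open>a S\<close> of orbits is monotone in \<open>S\<close>. Finally \<open>f\<^sub>i\<close> is the sum of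
  \<open>a S\<close> over the \<open>S\<close> with \<open>i - 1\<close> elements, so that counting pairs \<open>S \<subset> T\<close> with
  \<open>card T = card S + 1\<close> gives (c), from which (a) and (b) follow by arithmetic.
\<close>

section \<open>Permutation representations\<close>

text \<open>Two obstacles shape the argument. Merging stable blocks can enclose an edge, so merging
  is defined only on an invariant subset of the partitions of type T. Splitting a block involves
  arbitrary choices that the group does not respect, so the partitions of type S need not embed
  equivariantly into those of type T; but functions can be pulled back along the merging, and for
  this surjectivity is enough. A partition is stored as a coloring whose labels count the vertices
  in earlier blocks. Thus all sets involved carry the one action \<open>coloring_action\<close>, and
  merging is rounding labels down to \<open>insert 0 S\<close>. As for the numbers, write n for |N|.
  For i \<ge> 1 the coefficient f_i sums \<open>a S\<close> over binomial(n-1, i-1) sets, and (c)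
  says that the averages of these sums do not decrease as i grows. Then (a) and (b) reflect that
  binomial(n-1, i-1) is at most binomial(n-1, i) when 2i \<le> n.\<close>

definition perm_mat :: "(nat \<Rightarrow> 'x) \<Rightarrow> nat \<Rightarrow> ('x \<Rightarrow> 'x) \<Rightarrow> complex mat" where
  "perm_mat b n f = mat n n (\<lambda>(i, j). of_bool (f (b j) = b i))"

lemma perm_mat_carrier [simp]: "perm_mat b n f \<in> carrier_mat n n"
  by (simp add: perm_mat_def)

lemma perm_mat_cong:
  assumes "bij_betw b {..<n} X" "\<And>x. x \<in> X \<Longrightarrow> f x = f' x"
  shows "perm_mat b n f = perm_mat b n f'"
  using assms(2) bij_betw_apply[OF assms(1)] unfolding perm_mat_def by (intro cong_mat) auto

lemma perm_mat_id:
  assumes "bij_betw b {..<n} X" "\<And>x. x \<in> X \<Longrightarrow> f x = x"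
  shows "perm_mat b n f = 1\<^sub>m n"
proof (rule eq_matI)
  fix i j assume "i < dim_row (1\<^sub>m n :: complex mat)" "j < dim_col (1\<^sub>m n :: complex mat)"
  hence ij: "i < n" "j < n" by auto
  hence "b j \<in> X" using bij_betw_apply[OF assms(1)] by auto
  moreover have "b j = b i \<longleftrightarrow> i = j"
    using ij assms(1) by (auto simp: bij_betw_def inj_on_def)
  ultimately show "perm_mat b n f $$ (i, j) = 1\<^sub>m n $$ (i, j)"
    using ij assms(2) by (simp add: perm_mat_def)
qed (auto simp: perm_mat_def)

text \<open>Columns are indexed by the argument of the map, so composition becomes the product in
  the same order and a left action gives a homomorphism.\<close>

lemma perm_mat_mult:
  assumes b: "bij_betw b {..<n} X" and f': "\<And>x. x \<in> X \<Longrightarrow> f' x \<in> X"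
  shows "perm_mat b n f * perm_mat b n f' = perm_mat b n (f \<circ> f')"
proof (rule eq_matI)
  fix i j assume "i < dim_row (perm_mat b n (f \<circ> f'))" "j < dim_col (perm_mat b n (f \<circ> f'))"
  hence ij: "i < n" "j < n" by (auto simp: perm_mat_def)
  have "f' (b j) \<in> X" using ij b f' by (auto simp: bij_betw_def)
  then obtain k0 where k0: "k0 < n" "b k0 = f' (b j)"
    using b by (auto simp: bij_betw_def)
  have eq: "f' (b j) = b k \<longleftrightarrow> k = k0" if "k < n" for k
    using that k0 b by (auto simp: bij_betw_def inj_on_def)
  have "(perm_mat b n f * perm_mat b n f') $$ (i, j) =
      (\<Sum>k\<in>{0..<n}. of_bool (f (b k) = b i) * of_bool (f' (b j) = b k))"
    using ij by (simp add: perm_mat_def scalar_prod_def)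
  also have "\<dots> = (\<Sum>k\<in>{0..<n}. if k = k0 then of_bool (f (b k) = b i) else 0)"
    by (intro sum.cong) (auto simp: eq)
  also have "\<dots> = of_bool (f (f' (b j)) = b i)" using k0 by simp
  finally show "(perm_mat b n f * perm_mat b n f') $$ (i, j) = perm_mat b n (f \<circ> f') $$ (i, j)"
    using ij by (simp add: perm_mat_def)
qed (auto simp: perm_mat_def)

text \<open>A vector is read as a function on X, and the matrix composes it with the inverse
  \<open>f'\<close> of \<open>f\<close>. In this form equivariance of a pull-back can be checked one
  coordinate at a time.\<close>

lemma perm_mat_mult_vec:
  assumes b: "bij_betw b {..<n} X"
    and f': "\<And>x. x \<in> X \<Longrightarrow> f' x \<in> X" "\<And>x. x \<in> X \<Longrightarrow> f (f' x) = x" "\<And>x. x \<in> X \<Longrightarrow> f' (f x) = x"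
    and v: "v \<in> carrier_vec n" and i: "i < n"
  shows "(perm_mat b n f *\<^sub>v v) $ i = v $ (inv_into {..<n} b (f' (b i)))"
proof -
  have bi: "f' (b i) \<in> X" using i b f' by (auto simp: bij_betw_def)
  define k0 where "k0 = inv_into {..<n} b (f' (b i))"
  have k0: "k0 < n" "b k0 = f' (b i)"
    using bij_betw_apply[OF bij_betw_inv_into[OF b] bi] bij_betw_inv_into_right[OF b bi]
    by (simp_all add: k0_def)
  have eq: "f (b k) = b i \<longleftrightarrow> k = k0" if "k < n" for k
  proof
    have "b k \<in> X" "b i \<in> X" using that i b by (auto simp: bij_betw_def)
    {
      assume "f (b k) = b i"
      hence "b k = b k0" using f' k0 \<open>b k \<in> X\<close> by metis
      thus "k = k0" using that k0 b by (auto simp: bij_betw_def inj_on_def)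
    }
    assume "k = k0"
    thus "f (b k) = b i" using f' k0 \<open>b i \<in> X\<close> by simp
  qed
  have "(perm_mat b n f *\<^sub>v v) $ i = (\<Sum>k\<in>{0..<n}. of_bool (f (b k) = b i) * v $ k)"
    using i v by (simp add: perm_mat_def scalar_prod_def)
  also have "\<dots> = (\<Sum>k\<in>{0..<n}. if k = k0 then v $ k else 0)"
    by (intro sum.cong) (auto simp: eq)
  finally show ?thesis using k0 by (simp add: k0_def)
qed

text \<open>The axioms constrain \<open>act\<close> on X only, so that the same total function
  \<open>coloring_action\<close> can act on every invariant set of colorings.\<close>

locale finite_action = group G for G (structure) +
  fixes X :: "'x set" and act :: "'a \<Rightarrow> 'x \<Rightarrow> 'x"
  assumes finite_X: "finite X"
    and act_closed: "g \<in> carrier G \<Longrightarrow> x \<in> X \<Longrightarrow> act g x \<in> X"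
    and act_one: "x \<in> X \<Longrightarrow> act \<one> x = x"
    and act_mult: "g \<in> carrier G \<Longrightarrow> h \<in> carrier G \<Longrightarrow> x \<in> X \<Longrightarrow> act (g \<otimes> h) x = act g (act h x)"
begin

lemma act_inv:
  assumes "g \<in> carrier G" "x \<in> X"
  shows "act g (act (inv g) x) = x" "act (inv g) (act g x) = x"
  using assms act_mult[of g "inv g" x] act_mult[of "inv g" g x] act_one by auto

lemma perm_mat_representation:
  assumes b: "bij_betw b {..<n} X"
  shows "representation G n (\<lambda>g. perm_mat b n (act g))"
proof -
  have mult: "perm_mat b n (act g) * perm_mat b n (act h) = perm_mat b n (act (g \<otimes> h))"
    if "g \<in> carrier G" "h \<in> carrier G" for g h
  proof -
    have "perm_mat b n (act g) * perm_mat b n (act h) = perm_mat b n (act g \<circ> act h)"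
      using that act_closed by (intro perm_mat_mult[OF b])
    also have "\<dots> = perm_mat b n (act (g \<otimes> h))"
      using that by (intro perm_mat_cong[OF b]) (simp add: act_mult)
    finally show ?thesis .
  qed
  have one: "perm_mat b n (act \<one>) = 1\<^sub>m n"
    by (rule perm_mat_id[OF b]) (rule act_one)
  have "perm_mat b n (act g) \<in> Units (ring_mat TYPE(complex) n ())" if "g \<in> carrier G" for g
  proof -
    have "perm_mat b n (act (inv g)) * perm_mat b n (act g) = 1\<^sub>m n"
      "perm_mat b n (act g) * perm_mat b n (act (inv g)) = 1\<^sub>m n"
      using that one by (simp_all add: mult)
    thus ?thesis
      unfolding Units_def ring_mat_simps using perm_mat_carrier by blast
  qed
  thus ?thesis
    unfolding representation_def hom_def
    by (auto simp: units_of_carrier units_of_mult ring_mat_simps mult)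
qed

lemma perm_mat_has_character:
  assumes b: "bij_betw b {..<n} X"
  shows "has_character G n (\<lambda>g. perm_mat b n (act g)) (\<lambda>g. of_nat (card {x \<in> X. act g x = x}))"
proof -
  have "rep_character n (\<lambda>g. perm_mat b n (act g)) g = of_nat (card {x \<in> X. act g x = x})" for g
  proof -
    have "rep_character n (\<lambda>g. perm_mat b n (act g)) g = (\<Sum>i<n. of_bool (act g (b i) = b i))"
      by (simp add: rep_character_def perm_mat_def)
    also have "\<dots> = (\<Sum>x\<in>X. of_bool (act g x = x))"
      by (rule sum.reindex_bij_betw[OF b])
    also have "\<dots> = of_nat (card {x \<in> X. act g x = x})"
      using finite_X by (simp add: of_bool_def sum.If_cases Int_def)
    finally show ?thesis .
  qed
  thus ?thesis
    unfolding has_character_def using perm_mat_representation[OF b] by metis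
qed

text \<open>A point x is fixed by the conjugate of g by h exactly when \<open>act (inv h) x\<close>
  is fixed by g.\<close>

lemma class_function_permutation_character:
  "class_function G (\<lambda>g. of_nat (card {x \<in> X. act g x = x}))"
proof -
  have "card {x \<in> X. act (h \<otimes> g \<otimes> inv h) x = x} = card {x \<in> X. act g x = x}"
    if gh: "g \<in> carrier G" "h \<in> carrier G" for g h
  proof (rule bij_betw_same_card)
    have conj: "act (h \<otimes> g \<otimes> inv h) x = act h (act g (act (inv h) x))" if "x \<in> X" for x
      using gh that by (simp add: act_mult act_closed)
    show "bij_betw (act (inv h)) {x \<in> X. act (h \<otimes> g \<otimes> inv h) x = x} {x \<in> X. act g x = x}"
    proof (rule bij_betw_byWitness[where f' = "act h"])
      show "act (inv h) ` {x \<in> X. act (h \<otimes> g \<otimes> inv h) x = x} \<subseteq> {x \<in> X. act g x = x}"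
      proof clarify
        fix x assume x: "x \<in> X" "act (h \<otimes> g \<otimes> inv h) x = x"
        have "act (inv h) (act h (act g (act (inv h) x))) = act g (act (inv h) x)"
          using x gh by (intro act_inv act_closed) auto
        thus "act (inv h) x \<in> X \<and> act g (act (inv h) x) = act (inv h) x"
          using x gh act_closed[of "inv h" x] by (simp add: conj)
      qed
      show "act h ` {x \<in> X. act g x = x} \<subseteq> {x \<in> X. act (h \<otimes> g \<otimes> inv h) x = x}"
        using gh by (auto simp: act_closed conj act_inv)
    qed (use gh act_inv in auto)
  qed
  thus ?thesis by (simp add: class_function_def)
qed

lemma enumeration:
  obtains b :: "nat \<Rightarrow> 'x" where "bij_betw b {..<card X} X"
  using ex_bij_betw_nat_finite[OF finite_X] by (auto simp: atLeast0LessThan)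

end

text \<open>
  A partial equivariant map \<open>p\<close> from \<open>Z\<close> onto \<open>X\<close> makes functions on \<open>X\<close> a submodule of
  the functions on \<open>Z\<close>, by pulling back along \<open>p\<close> and extending by zero.
\<close>

lemma perm_mat_submodule:
  assumes "finite_action G X actX" "finite_action G Z actZ"
    and Y: "Y \<subseteq> Z" "\<And>g y. g \<in> carrier G \<Longrightarrow> y \<in> Y \<Longrightarrow> actZ g y \<in> Y"
    and p: "p ` Y = X" "\<And>g y. g \<in> carrier G \<Longrightarrow> y \<in> Y \<Longrightarrow> p (actZ g y) = actX g (p y)"
    and b: "bij_betw b {..<n} X" and c: "bij_betw c {..<m} Z"
  shows "isomorphic_to_submodule G n (\<lambda>g. perm_mat b n (actX g)) m (\<lambda>g. perm_mat c m (actZ g))"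
proof -
  interpret X: finite_action G X actX by fact
  interpret Z: finite_action G Z actZ by fact
  define idx where "idx x = inv_into {..<n} b x" for x
  have idx: "idx x < n" "b (idx x) = x" if "x \<in> X" for x
    using bij_betw_apply[OF bij_betw_inv_into[OF b] that] bij_betw_inv_into_right[OF b that]
    by (simp_all add: idx_def)
  have idx_b: "idx (b i) = i" if "i < n" for i
    using that b unfolding idx_def by (simp add: bij_betw_inv_into_left)
  have c_in: "c i \<in> Z" if "i < m" for i using that c by (auto simp: bij_betw_def)
  have idx_lt: "idx (p z) < n" if "z \<in> Y" for z using that p(1) idx(1) by auto
  define \<phi> where "\<phi> v = vec m (\<lambda>i. if c i \<in> Y then v $ idx (p (c i)) else 0)" for v :: "complex vec"
  define U where "U = \<phi> ` carrier_vec n"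
  have phi_in: "\<phi> v \<in> carrier_vec m" for v by (simp add: \<phi>_def)
  have phi_add: "\<phi> (v + w) = \<phi> v + \<phi> w" if "v \<in> carrier_vec n" "w \<in> carrier_vec n" for v w
    using that idx_lt by (intro eq_vecI) (auto simp: \<phi>_def)
  have phi_smult: "\<phi> (r \<cdot>\<^sub>v v) = r \<cdot>\<^sub>v \<phi> v" if "v \<in> carrier_vec n" for r v
    using that idx_lt by (intro eq_vecI) (auto simp: \<phi>_def)
  have phi_zero: "\<phi> (0\<^sub>v n) = 0\<^sub>v m"
    using idx_lt by (intro eq_vecI) (auto simp: \<phi>_def)
  have equiv: "\<phi> (perm_mat b n (actX g) *\<^sub>v v) = perm_mat c m (actZ g) *\<^sub>v \<phi> v"
    if g: "g \<in> carrier G" and v: "v \<in> carrier_vec n" for g v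
  proof (rule eq_vecI)
    fix i assume "i < dim_vec (perm_mat c m (actZ g) *\<^sub>v \<phi> v)"
    hence i: "i < m" by (simp add: perm_mat_def)
    define z where "z = actZ (inv\<^bsub>G\<^esub> g) (c i)"
    have inv_g: "inv\<^bsub>G\<^esub> g \<in> carrier G" using g by simp
    have z: "z \<in> Z" unfolding z_def using inv_g c_in[OF i] by (rule Z.act_closed)
    \<comment> \<open>Y is invariant under g and under its inverse, hence so is the complement of Y
      in Z; this is why extension by zero commutes with the action.\<close>
    have zY: "z \<in> Y \<longleftrightarrow> c i \<in> Y"
    proof
      assume "z \<in> Y"
      thus "c i \<in> Y" using Y(2)[OF g, of z] Z.act_inv(1)[OF g c_in[OF i]] by (simp add: z_def)
    qed (simp add: z_def Y(2)[OF inv_g])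
    have "(perm_mat c m (actZ g) *\<^sub>v \<phi> v) $ i = \<phi> v $ inv_into {..<m} c z"
      unfolding z_def
      by (rule perm_mat_mult_vec[OF c Z.act_closed[OF inv_g] Z.act_inv[OF g] phi_in i])
    also have "\<dots> = (if z \<in> Y then v $ idx (p z) else 0)"
      using bij_betw_apply[OF bij_betw_inv_into[OF c] z] bij_betw_inv_into_right[OF c z]
      by (simp add: \<phi>_def)
    also have "\<dots> = (if c i \<in> Y then (perm_mat b n (actX g) *\<^sub>v v) $ idx (p (c i)) else 0)"
    proof (cases "c i \<in> Y")
      case True
      hence "p (c i) \<in> X" using p by auto
      hence "(perm_mat b n (actX g) *\<^sub>v v) $ idx (p (c i))
          = v $ inv_into {..<n} b (actX (inv\<^bsub>G\<^esub> g) (b (idx (p (c i)))))"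
        by (intro perm_mat_mult_vec[OF b X.act_closed[OF inv_g] X.act_inv[OF g] v] idx)
      thus ?thesis
        using True zY idx \<open>p (c i) \<in> X\<close> p(2)[OF inv_g True] by (simp add: z_def idx_def)
    qed (simp add: zY)
    also have "\<dots> = \<phi> (perm_mat b n (actX g) *\<^sub>v v) $ i" using i by (simp add: \<phi>_def)
    finally show "\<phi> (perm_mat b n (actX g) *\<^sub>v v) $ i = (perm_mat c m (actZ g) *\<^sub>v \<phi> v) $ i" ..
  qed (simp add: \<phi>_def perm_mat_def)
  have "inj_on \<phi> (carrier_vec n)"
  proof (rule inj_onI)
    fix v w assume vw: "v \<in> carrier_vec n" "w \<in> carrier_vec n" "\<phi> v = \<phi> w"
    show "v = w"
    proof (rule eq_vecI)
      fix i assume "i < dim_vec w"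
      hence i: "i < n" using vw by simp
      \<comment> \<open>Surjectivity of p gives injectivity of the pull-back: coordinate i of a
        vector can be read off at any preimage of \<open>b i\<close>.\<close>
      hence "b i \<in> p ` Y" using b p by (auto simp: bij_betw_def)
      then obtain y where y: "y \<in> Y" "p y = b i" by auto
      obtain k where k: "k < m" "c k = y" using y Y(1) c by (auto simp: bij_betw_def)
      have "\<phi> v $ k = v $ i" "\<phi> w $ k = w $ i" using y k idx_b[OF i] by (auto simp: \<phi>_def)
      thus "v $ i = w $ i" using vw by simp
    qed (use vw in auto)
  qed
  hence bij: "bij_betw \<phi> (carrier_vec n) U" by (auto simp: U_def bij_betw_def)
  have "submodule class_ring U (module_vec TYPE(complex) m)"
  proof (rule submodule.intro)
    show "Module.module (class_ring :: complex ring) (module_vec TYPE(complex) m)" by (rule vec_module)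
    show "U \<subseteq> carrier (module_vec TYPE(complex) m)"
      using phi_in by (auto simp: U_def module_vec_simps)
    show "v \<oplus>\<^bsub>module_vec TYPE(complex) m\<^esub> w \<in> U" if vw: "v \<in> U" "w \<in> U" for v w
    proof -
      obtain v' w' where v': "v' \<in> carrier_vec n" "v = \<phi> v'" and w': "w' \<in> carrier_vec n" "w = \<phi> w'"
        using vw by (auto simp: U_def)
      have "v + w = \<phi> (v' + w')" using v' w' by (simp add: phi_add)
      thus ?thesis using v'(1) w'(1) by (simp add: U_def module_vec_simps)
    qed
    show "\<zero>\<^bsub>module_vec TYPE(complex) m\<^esub> \<in> U"
      unfolding U_def module_vec_simps phi_zero[symmetric] by simp
    show "r \<odot>\<^bsub>module_vec TYPE(complex) m\<^esub> v \<in> U" if vU: "v \<in> U" for r v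
    proof -
      obtain v' where v': "v' \<in> carrier_vec n" "v = \<phi> v'" using vU by (auto simp: U_def)
      have "r \<cdot>\<^sub>v v = \<phi> (r \<cdot>\<^sub>v v')" using v' by (simp add: phi_smult)
      thus ?thesis using v'(1) by (simp add: U_def module_vec_simps)
    qed
  qed
  hence "VectorSpace.subspace class_ring U (module_vec TYPE(complex) m)"
    by (intro VectorSpace.subspace.intro vec_vs)
  moreover have "perm_mat c m (actZ g) *\<^sub>v u \<in> U" if gu: "g \<in> carrier G" "u \<in> U" for g u
  proof -
    obtain v where v: "v \<in> carrier_vec n" "u = \<phi> v" using gu(2) by (auto simp: U_def)
    have "perm_mat b n (actX g) *\<^sub>v v \<in> carrier_vec n"
      using v(1) by (rule mult_mat_vec_carrier[OF perm_mat_carrier])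
    thus ?thesis unfolding v(2) U_def equiv[OF gu(1) v(1), symmetric] by (rule imageI)
  qed
  ultimately have "subrepresentation G m (\<lambda>g. perm_mat c m (actZ g)) U"
    by (simp add: subrepresentation_def)
  moreover have "\<phi> \<in> LinearCombinations.module_hom class_ring (module_vec TYPE(complex) n)
      ((module_vec TYPE(complex) m)\<lparr>carrier := U\<rparr>)"
    unfolding LinearCombinations.module_hom_def mem_Collect_eq
    by (simp add: module_vec_simps U_def phi_add phi_smult)
  ultimately show ?thesis
    unfolding isomorphic_to_submodule_def
    by (intro exI[of _ U] exI[of _ \<phi>] conjI ballI bij equiv)
qed

text \<open>The values of \<chi> and \<psi> are prescribed on the carrier only, because an expansion
  determines its coefficients only on the group.\<close>

lemma char_le_permutation_characters:
  assumes X: "finite_action G X actX" and Z: "finite_action G Z actZ"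
    and Y: "Y \<subseteq> Z" "\<And>g y. g \<in> carrier G \<Longrightarrow> y \<in> Y \<Longrightarrow> actZ g y \<in> Y"
    and p: "p ` Y = X" "\<And>g y. g \<in> carrier G \<Longrightarrow> y \<in> Y \<Longrightarrow> p (actZ g y) = actX g (p y)"
    and \<chi>: "\<And>g. g \<in> carrier G \<Longrightarrow> \<chi> g = of_nat (card {x \<in> X. actX g x = x})"
    and \<psi>: "\<And>g. g \<in> carrier G \<Longrightarrow> \<psi> g = of_nat (card {z \<in> Z. actZ g z = z})"
  shows "char_le G \<chi> \<psi>"
proof -
  obtain b where b: "bij_betw b {..<card X} X" by (rule finite_action.enumeration[OF X])
  obtain c where c: "bij_betw c {..<card Z} Z" by (rule finite_action.enumeration[OF Z])
  have "has_character G (card X) (\<lambda>g. perm_mat b (card X) (actX g)) \<chi>"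
    using finite_action.perm_mat_has_character[OF X b] \<chi> by (simp add: has_character_def)
  moreover have "has_character G (card Z) (\<lambda>g. perm_mat c (card Z) (actZ g)) \<psi>"
    using finite_action.perm_mat_has_character[OF Z c] \<psi> by (simp add: has_character_def)
  moreover have "isomorphic_to_submodule G (card X) (\<lambda>g. perm_mat b (card X) (actX g))
      (card Z) (\<lambda>g. perm_mat c (card Z) (actZ g))"
    by (rule perm_mat_submodule[of G X actX Z actZ Y p, OF X Z]) (fact Y p b c)+
  ultimately show ?thesis
    unfolding char_le_def
    by (intro exI[of _ "card X"] exI[of _ "\<lambda>g. perm_mat b (card X) (actX g)"]
        exI[of _ "card Z"] exI[of _ "\<lambda>g. perm_mat c (card Z) (actZ g)"] conjI)
qed

lemma is_character_permutation_character:
  assumes X: "finite_action G X act"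
    and \<chi>: "\<And>g. g \<in> carrier G \<Longrightarrow> \<chi> g = of_nat (card {x \<in> X. act g x = x})"
  shows "is_character G \<chi>"
proof -
  obtain b where b: "bij_betw b {..<card X} X" by (rule finite_action.enumeration[OF X])
  have "has_character G (card X) (\<lambda>g. perm_mat b (card X) (act g)) \<chi>"
    using finite_action.perm_mat_has_character[OF X b] \<chi> by (simp add: has_character_def)
  thus ?thesis unfolding is_character_def by (intro exI)
qed

section \<open>Orbit counting\<close>

lemma orbits_eq_image: "orbits G X act = orbit G act ` X"
  by (auto simp: orbits_def)

context finite_action
begin

lemma finite_orbits: "finite (orbits G X act)"
  by (simp add: orbits_eq_image finite_X)

lemma mem_orbit: "x \<in> X \<Longrightarrow> x \<in> orbit G act x"
  unfolding orbit_def using act_one[of x, symmetric] one_closed by blast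

lemma orbit_subset: "x \<in> X \<Longrightarrow> orbit G act x \<subseteq> X"
  using act_closed by (auto simp: orbit_def)

lemma finite_action_subset:
  assumes "Y \<subseteq> X" "\<And>g y. g \<in> carrier G \<Longrightarrow> y \<in> Y \<Longrightarrow> act g y \<in> Y"
  shows "finite_action G Y act"
  using assms act_one act_mult finite_subset[OF _ finite_X] by unfold_locales auto

end

lemma orbit_image:
  assumes "\<And>g. g \<in> carrier G \<Longrightarrow> p (actZ g y) = actX g (p y)"
  shows "orbit G actX (p y) = p ` orbit G actZ y"
  unfolding orbit_def image_Collect using assms by metis

text \<open>An equivariant map sends orbits to orbits, so it induces a surjection from the orbits of
  Y onto those of its image.\<close>

lemma card_orbits_image_le:
  assumes Y: "finite_action G Y act"
    and p: "\<And>g y. g \<in> carrier G \<Longrightarrow> y \<in> Y \<Longrightarrow> p (act g y) = actX g (p y)"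
  shows "card (orbits G (p ` Y) actX) \<le> card (orbits G Y act)"
proof -
  have "orbits G (p ` Y) actX = (`) p ` orbits G Y act"
    unfolding orbits_eq_image image_image using p by (intro image_cong orbit_image) auto
  thus ?thesis using card_image_le[OF finite_action.finite_orbits[OF Y]] by simp
qed

lemma card_orbits_image:
  assumes Y: "finite_action G Y act" and inj: "inj_on p Y"
    and p: "\<And>g y. g \<in> carrier G \<Longrightarrow> y \<in> Y \<Longrightarrow> p (act g y) = actX g (p y)"
  shows "card (orbits G (p ` Y) actX) = card (orbits G Y act)"
proof -
  have "orbits G (p ` Y) actX = (`) p ` orbits G Y act"
    unfolding orbits_eq_image image_image using p by (intro image_cong orbit_image) auto
  moreover have "inj_on ((`) p) (orbits G Y act)"
    using inj finite_action.orbit_subset[OF Y]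
    by (intro inj_on_subset[OF inj_on_image_Pow]) (auto simp: orbits_eq_image)
  ultimately show ?thesis by (simp add: card_image)
qed

lemma card_orbits_mono:
  assumes "finite_action G Z act" "Y \<subseteq> Z"
  shows "card (orbits G Y act) \<le> card (orbits G Z act)"
  unfolding orbits_eq_image
  using assms finite_action.finite_X[OF assms(1)] by (intro card_mono) auto

text \<open>Each piece is invariant and each point lies in its own orbit, so disjoint pieces share
  no orbit.\<close>

lemma card_orbits_UNION:
  assumes "finite I" and X: "\<And>i. i \<in> I \<Longrightarrow> finite_action G (X i) act"
    and disj: "\<And>i j. i \<in> I \<Longrightarrow> j \<in> I \<Longrightarrow> i \<noteq> j \<Longrightarrow> X i \<inter> X j = {}"
  shows "card (orbits G (\<Union>i\<in>I. X i) act) = (\<Sum>i\<in>I. card (orbits G (X i) act))"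
proof -
  have "orbits G (\<Union>i\<in>I. X i) act = (\<Union>i\<in>I. orbits G (X i) act)"
    by (auto simp: orbits_eq_image)
  moreover have "orbits G (X i) act \<inter> orbits G (X j) act = {}" if "i \<in> I" "j \<in> I" "i \<noteq> j" for i j
  proof (rule ccontr)
    assume "orbits G (X i) act \<inter> orbits G (X j) act \<noteq> {}"
    then obtain x y where xy: "x \<in> X i" "y \<in> X j" "orbit G act x = orbit G act y"
      by (auto simp: orbits_eq_image)
    hence "x \<in> X i \<inter> X j"
      using that finite_action.mem_orbit[OF X, of i x] finite_action.orbit_subset[OF X, of j y] by auto
    thus False using disj that by blast
  qed
  ultimately show ?thesis
    using \<open>finite I\<close> finite_action.finite_orbits[OF X] by (simp add: card_UN_disjoint)
qed

section \<open>Monomials and compositions\<close>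

definition coloring_monomial :: "'a set \<Rightarrow> ('a \<Rightarrow> nat) \<Rightarrow> (nat \<Rightarrow>\<^sub>0 nat)" where
  "coloring_monomial N f = (\<Sum>v\<in>N. Poly_Mapping.single (f v) 1)"

text \<open>The bound is strict: for the monomial of a coloring this counts the vertices of color
  below x, so its value at a used color is the label of that color's block.\<close>

definition cum :: "(nat \<Rightarrow>\<^sub>0 nat) \<Rightarrow> nat \<Rightarrow> nat" where
  "cum m x = (\<Sum>k<x. Poly_Mapping.lookup m k)"

definition total_degree :: "(nat \<Rightarrow>\<^sub>0 nat) \<Rightarrow> nat" where
  "total_degree m = (\<Sum>k\<in>Poly_Mapping.keys m. Poly_Mapping.lookup m k)"

text \<open>This is the S for which \<alpha>(S) lists the exponents of m in the order of the
  variables. Along the keys of a non-zero m, \<open>cum m\<close> takes the values 0, \<alpha>1,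
  \<alpha>1 + \<alpha>2, and so on; the total degree is not among them, and 0 comes from the first
  key.\<close>

definition set_of_monomial :: "(nat \<Rightarrow>\<^sub>0 nat) \<Rightarrow> nat set" where
  "set_of_monomial m = cum m ` Poly_Mapping.keys m - {0}"

definition monomial_of :: "nat list \<Rightarrow> nat list \<Rightarrow> (nat \<Rightarrow>\<^sub>0 nat)" where
  "monomial_of ks \<alpha> = (\<Sum>j<length \<alpha>. Poly_Mapping.single (ks ! j) (\<alpha> ! j))"

lemma lookup_coloring_monomial:
  assumes "finite N"
  shows "Poly_Mapping.lookup (coloring_monomial N f) k = card {v \<in> N. f v = k}"
proof -
  have "Poly_Mapping.lookup (coloring_monomial N f) k = (\<Sum>v\<in>N. if f v = k then 1 else 0)"
    unfolding coloring_monomial_def lookup_sum by (intro sum.cong) (auto simp: lookup_single when_def)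
  also have "\<dots> = card {v \<in> N. f v = k}" using assms by (simp flip: sum.inter_filter)
  finally show ?thesis .
qed

lemma keys_coloring_monomial:
  assumes "finite N"
  shows "Poly_Mapping.keys (coloring_monomial N f) = f ` N"
  using assms by (auto simp: in_keys_iff lookup_coloring_monomial card_eq_0_iff)

lemma cum_coloring_monomial:
  assumes "finite N"
  shows "cum (coloring_monomial N f) x = card {v \<in> N. f v < x}"
proof -
  have "{v \<in> N. f v < x} = (\<Union>k<x. {v \<in> N. f v = k})" by auto
  also have "card \<dots> = (\<Sum>k<x. card {v \<in> N. f v = k})"
    using assms by (intro card_UN_disjoint) auto
  finally show ?thesis by (simp add: cum_def lookup_coloring_monomial[OF assms])
qed

lemma total_degree_coloring_monomial:
  assumes "finite N"
  shows "total_degree (coloring_monomial N f) = card N"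
proof -
  have "card N = card (\<Union>k\<in>f ` N. {v \<in> N. f v = k})" by (rule arg_cong[of _ _ card]) auto
  also have "\<dots> = (\<Sum>k\<in>f ` N. card {v \<in> N. f v = k})"
    using assms by (intro card_UN_disjoint) auto
  finally show ?thesis by (simp add: total_degree_def lookup_coloring_monomial[OF assms] keys_coloring_monomial[OF assms])
qed

lemma cum_Suc: "cum m (Suc k) = cum m k + Poly_Mapping.lookup m k"
  by (simp add: cum_def)

lemma cum_mono: "x \<le> y \<Longrightarrow> cum m x \<le> cum m y"
  unfolding cum_def by (rule sum_mono2) auto

lemma cum_less:
  assumes "k \<in> Poly_Mapping.keys m" "k < y"
  shows "cum m k < cum m y"
proof -
  have "cum m k < cum m (Suc k)" using assms(1) by (simp add: cum_Suc in_keys_iff)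
  also have "\<dots> \<le> cum m y" using assms(2) by (intro cum_mono) simp
  finally show ?thesis .
qed

text \<open>Passing the key j makes \<open>cum m\<close> grow, whatever k is. Hence relabelling used
  colors by \<open>cum m\<close> preserves and reflects their order.\<close>

lemma cum_less_iff:
  assumes "j \<in> Poly_Mapping.keys m"
  shows "cum m j < cum m k \<longleftrightarrow> j < k"
  using cum_less[OF assms, of k] cum_mono[of k j m] by (cases "j < k") auto

lemma inj_on_cum: "inj_on (cum m) (Poly_Mapping.keys m)"
  
proof (rule inj_onI)
  fix j k assume "j \<in> Poly_Mapping.keys m" "k \<in> Poly_Mapping.keys m" "cum m j = cum m k"
  thus "j = k" using cum_less_iff[of j m k] cum_less_iff[of k m j] by simp
qed

lemma cum_le_total_degree: "cum m x \<le> total_degree m"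
proof -
  have "cum m x = (\<Sum>k\<in>{..<x} \<inter> Poly_Mapping.keys m. Poly_Mapping.lookup m k)"
    unfolding cum_def by (intro sum.mono_neutral_right) (auto simp: in_keys_iff)
  also have "\<dots> \<le> total_degree m" unfolding total_degree_def by (rule sum_mono2) auto
  finally show ?thesis .
qed

lemma cum_eq_total_degree:
  assumes "\<And>k. k \<in> Poly_Mapping.keys m \<Longrightarrow> k < x"
  shows "cum m x = total_degree m"
  unfolding cum_def total_degree_def
  using assms by (intro sum.mono_neutral_right) (auto simp: in_keys_iff)

lemma set_of_monomial_subset: "set_of_monomial m \<subseteq> {1..total_degree m - 1}"
proof
  fix s assume "s \<in> set_of_monomial m"
  then obtain k where k: "k \<in> Poly_Mapping.keys m" "s = cum m k" "s \<noteq> 0"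
    by (auto simp: set_of_monomial_def)
  have "s < cum m (Suc k)" using k by (simp add: cum_Suc in_keys_iff)
  also have "\<dots> \<le> total_degree m" by (rule cum_le_total_degree)
  finally show "s \<in> {1..total_degree m - 1}" using k by auto
qed

lemma zero_in_cum_keys:
  assumes "Poly_Mapping.keys m \<noteq> {}"
  shows "0 \<in> cum m ` Poly_Mapping.keys m"
proof -
  define k where "k = Min (Poly_Mapping.keys m)"
  have k: "k \<in> Poly_Mapping.keys m" using assms by (simp add: k_def)
  have "j \<notin> Poly_Mapping.keys m" if "j < k" for j
  proof
    assume "j \<in> Poly_Mapping.keys m"
    hence "k \<le> j" unfolding k_def by (intro Min_le) auto
    thus False using that by simp
  qed
  hence "cum m k = 0" by (simp add: cum_def in_keys_iff)
  thus ?thesis using k by force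
qed

text \<open>Exponents are differences of consecutive values of \<open>cum\<close>. Thus a coloring
  can be shown to have monomial m by counting vertices below each threshold.\<close>

lemma poly_mapping_eqI_cum:
  assumes "\<And>x. cum m x = cum m' x"
  shows "m = m'"
proof (rule poly_mapping_eqI)
  show "Poly_Mapping.lookup m k = Poly_Mapping.lookup m' k" for k
    using assms[of k] assms[of "Suc k"] by (simp add: cum_Suc)
qed

subsection \<open>Partial sums of compositions\<close>

text \<open>The index stays below the length: a nonempty list contributes the initial 0 but not its
  total. What remains after deleting 0 is the subset that corresponds to a composition.\<close>

definition psums :: "nat list \<Rightarrow> nat list" where
  "psums \<alpha> = map (\<lambda>j. sum_list (take j \<alpha>)) [0..<length \<alpha>]"

lemma sum_list_take_Suc: "j < length \<alpha> \<Longrightarrow> sum_list (take (Suc j) \<alpha>) = sum_list (take j \<alpha>) + \<alpha> ! j"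
  for \<alpha> :: "nat list"
  by (simp add: take_Suc_conv_app_nth)

lemma sum_list_take_mono: "i \<le> j \<Longrightarrow> sum_list (take i \<alpha>) \<le> sum_list (take j \<alpha>)"
  for \<alpha> :: "nat list"
  using sum_list_append[of "take i \<alpha>" "take (j - i) (drop i \<alpha>)"]
  by (simp flip: take_add)

lemma sorted_psums:
  assumes "\<And>a. a \<in> set \<alpha> \<Longrightarrow> 0 < a"
  shows "sorted_wrt (<) (psums \<alpha>)"
proof -
  have "sum_list (take i \<alpha>) < sum_list (take j \<alpha>)" if "i < j" "j < length \<alpha>" for i j
  proof -
    have "sum_list (take i \<alpha>) < sum_list (take (Suc i) \<alpha>)"
      using that assms[of "\<alpha> ! i"] by (simp add: sum_list_take_Suc)
    also have "\<dots> \<le> sum_list (take j \<alpha>)" using that by (intro sum_list_take_mono) simp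
    finally show ?thesis .
  qed
  thus ?thesis by (auto simp: psums_def sorted_wrt_iff_nth_less)
qed

lemma zero_in_psums: "0 \<in> set (psums \<alpha>) \<longleftrightarrow> \<alpha> \<noteq> []"
proof (cases \<alpha>)
  case (Cons a \<beta>)
  hence "psums \<alpha> ! 0 = 0" "0 < length (psums \<alpha>)" by (simp_all add: psums_def del: upt_Suc)
  thus ?thesis using Cons nth_mem[of 0 "psums \<alpha>"] by simp
qed (simp add: psums_def)

text \<open>The entries of a composition are the differences of its successive partial sums, and
  sorting recovers the order of these sums from their set.\<close>

lemma composition_eqI:
  assumes pos: "\<And>a. a \<in> set \<alpha> \<Longrightarrow> 0 < a" "\<And>b. b \<in> set \<beta> \<Longrightarrow> 0 < b"
    and sum: "sum_list \<alpha> = sum_list \<beta>"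
    and psums: "set (psums \<alpha>) - {0} = set (psums \<beta>) - {0}"
  shows "\<alpha> = \<beta>"
proof -
  have nil: "\<gamma> = [] \<longleftrightarrow> sum_list \<gamma> = 0" if "\<And>a. a \<in> set \<gamma> \<Longrightarrow> 0 < a" for \<gamma> :: "nat list"
    using that by (cases \<gamma>) auto
  \<comment> \<open>Deleting 0 loses nothing: it is a partial sum exactly for nonempty lists, that
    is, when the common total is non-zero.\<close>
  have "0 \<in> set (psums \<alpha>) \<longleftrightarrow> 0 \<in> set (psums \<beta>)"
    unfolding zero_in_psums using nil[of \<alpha>, OF pos(1)] nil[of \<beta>, OF pos(2)] sum by metis
  hence "set (psums \<alpha>) = set (psums \<beta>)" using psums by blast
  hence eq: "psums \<alpha> = psums \<beta>"
    using sorted_psums[OF pos(1)] sorted_psums[OF pos(2)] by (intro strict_sorted_equal) auto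
  hence len: "length \<alpha> = length \<beta>" 
    using arg_cong[OF eq, of length] unfolding psums_def length_map length_upt by simp
  have take: "sum_list (take j \<alpha>) = sum_list (take j \<beta>)" if "j \<le> length \<alpha>" for j
  proof (cases "j = length \<alpha>")
    case False
    hence "psums \<alpha> ! j = psums \<beta> ! j" "j < length \<alpha>" using eq that by auto
    thus ?thesis using len by (simp add: psums_def)
  qed (use sum len in simp)
  show ?thesis
  proof (rule nth_equalityI[OF len])
    fix j assume j: "j < length \<alpha>"
    show "\<alpha> ! j = \<beta> ! j"
      using take[of j] take[of "Suc j"] j len by (simp add: sum_list_take_Suc)
  qed
qed

lemma length_composition_of_set:
  assumes "finite S"
  shows "length (composition_of_set n S) = (if n = 0 then 0 else Suc (card S))"
  by (simp add: composition_of_set_def Let_def)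

lemma composition_of_set:
  assumes S: "S \<subseteq> {1..n - 1}"
  shows "a \<in> set (composition_of_set n S) \<Longrightarrow> 0 < a"
    and "sum_list (composition_of_set n S) = n"
    and "set (psums (composition_of_set n S)) - {0} = S"
proof -
  define s where "s = sorted_list_of_set S"
  \<comment> \<open>The parts are the consecutive differences of \<open>t\<close>, so the sum of the
    first j parts telescopes to \<open>t ! j\<close>.\<close>
  define t where "t = 0 # s @ [n]"
  define \<alpha> where "\<alpha> = composition_of_set n S"
  have fin: "finite S" using S finite_subset by blast
  hence s: "set s = S" "sorted_wrt (<) s" "length s = card S" by (simp_all add: s_def)
  have "(\<forall>a\<in>set \<alpha>. 0 < a) \<and> sum_list \<alpha> = n \<and> set (psums \<alpha>) - {0} = S"
  proof (cases "n = 0")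
    case True
    hence "S = {}" using S by auto
    thus ?thesis using True by (simp add: \<alpha>_def composition_of_set_def psums_def)
  next
    case False
    have t: "sorted_wrt (<) t"
      using s S False by (fastforce simp: t_def sorted_wrt_append)
    have len: "length \<alpha> = Suc (card S)" using False fin by (simp add: \<alpha>_def length_composition_of_set)
    have nth: "\<alpha> ! j = t ! Suc j - t ! j" if "j \<le> card S" for j
      using that s False
      by (cases j) (simp_all add: \<alpha>_def composition_of_set_def t_def s_def[symmetric] Let_def nth_append)
    have less: "t ! j < t ! Suc j" if "j \<le> card S" for j
      using that s(3) by (intro sorted_wrt_nth_less[OF t]) (auto simp: t_def)
    have take: "sum_list (take j \<alpha>) = t ! j" if "j \<le> Suc (card S)" for j
      using that
    proof (induction j)
      case (Suc j)
      thus ?case using less[of j] by (simp add: sum_list_take_Suc len nth)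
    qed (simp add: t_def)
    have "psums \<alpha> = 0 # s"
    proof (rule nth_equalityI)
      fix j assume "j < length (psums \<alpha>)"
      thus "psums \<alpha> ! j = (0 # s) ! j"
        using len take[of j] s(3) by (cases j) (simp_all add: psums_def t_def nth_append del: upt_Suc)
    qed (simp add: psums_def len s)
    hence "set (psums \<alpha>) - {0} = S" using s S by auto
    moreover have "sum_list \<alpha> = n"
      using take[of "Suc (card S)"] s(3) by (simp add: len t_def nth_append)
    moreover have "\<forall>a\<in>set \<alpha>. 0 < a"
      using nth less by (auto simp: in_set_conv_nth len less_Suc_eq_le)
    ultimately show ?thesis by blast
  qed
  thus "a \<in> set (composition_of_set n S) \<Longrightarrow> 0 < a"
    and "sum_list (composition_of_set n S) = n"
    and "set (psums (composition_of_set n S)) - {0} = S"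
    by (auto simp: \<alpha>_def)
qed

subsection \<open>Coefficients of monomial quasisymmetric functions\<close>

text \<open>The variables are distinct, so no exponents get added up, and the parts are positive, so
  every variable is a key. Since the variables increase, \<open>cum\<close> at the j-th of them is
  the j-th partial sum.\<close>

lemma monomial_of:
  assumes ks: "sorted_wrt (<) ks" "length ks = length \<alpha>" and pos: "\<And>a. a \<in> set \<alpha> \<Longrightarrow> 0 < a"
  shows "Poly_Mapping.keys (monomial_of ks \<alpha>) = set ks"
    and "j < length \<alpha> \<Longrightarrow> Poly_Mapping.lookup (monomial_of ks \<alpha>) (ks ! j) = \<alpha> ! j"
    and "total_degree (monomial_of ks \<alpha>) = sum_list \<alpha>"
    and "set_of_monomial (monomial_of ks \<alpha>) = set (psums \<alpha>) - {0}"
proof -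
  let ?m = "monomial_of ks \<alpha>"
  have less: "ks ! i < ks ! j \<longleftrightarrow> i < j" if "i < length \<alpha>" "j < length \<alpha>" for i j
    using that ks sorted_wrt_nth_less[OF ks(1), of i j] sorted_wrt_nth_less[OF ks(1), of j i]
    by (cases i j rule: linorder_cases) auto
  have lookup: "Poly_Mapping.lookup ?m k = (\<Sum>j<length \<alpha>. if ks ! j = k then \<alpha> ! j else 0)" for k
    unfolding monomial_of_def lookup_sum by (intro sum.cong) (auto simp: lookup_single when_def)
  have nth: "Poly_Mapping.lookup ?m (ks ! j) = \<alpha> ! j" if "j < length \<alpha>" for j
  proof -
    have "Poly_Mapping.lookup ?m (ks ! j) = (\<Sum>i<length \<alpha>. if i = j then \<alpha> ! i else 0)"
      unfolding lookup using less that 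
    proof (intro sum.cong refl)
      fix i assume "i \<in> {..<length \<alpha>}"
      hence "ks ! i = ks ! j \<longleftrightarrow> i = j"
        using less[of i j] less[of j i] that by (cases i j rule: linorder_cases) auto
      thus "(if ks ! i = ks ! j then \<alpha> ! i else 0) = (if i = j then \<alpha> ! i else 0)" by simp
    qed
    thus ?thesis using that by simp
  qed
  thus "j < length \<alpha> \<Longrightarrow> Poly_Mapping.lookup ?m (ks ! j) = \<alpha> ! j" .
  have "set ks \<subseteq> Poly_Mapping.keys ?m"
  proof
    fix k assume "k \<in> set ks"
    then obtain j where j: "j < length \<alpha>" "k = ks ! j" using ks(2) by (auto simp: in_set_conv_nth)
    thus "k \<in> Poly_Mapping.keys ?m" using nth[OF j(1)] pos[of "\<alpha> ! j"] by (simp add: in_keys_iff)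
  qed
  moreover have "Poly_Mapping.keys ?m \<subseteq> set ks"
  proof
    fix k assume "k \<in> Poly_Mapping.keys ?m"
    hence "(\<Sum>j<length \<alpha>. if ks ! j = k then \<alpha> ! j else 0) \<noteq> 0" by (simp add: in_keys_iff lookup)
    then obtain j where "j < length \<alpha>" "ks ! j = k"
      by (rule sum.not_neutral_contains_not_neutral) (auto split: if_splits)
    thus "k \<in> set ks" using ks(2) by auto
  qed
  ultimately show keys: "Poly_Mapping.keys ?m = set ks" by blast
  have sumlist: "sum_list (take j \<alpha>) = (\<Sum>i<j. \<alpha> ! i)" if "j \<le> length \<alpha>" for j
    using that by (simp add: sum_list_sum_nth atLeast0LessThan)
  have set_ks: "set ks = (!) ks ` {..<length \<alpha>}"
    using ks(2) by (auto simp: set_conv_nth)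
  have inj: "inj_on ((!) ks) {..<length \<alpha>}"
  proof (rule inj_onI)
    fix i j assume "i \<in> {..<length \<alpha>}" "j \<in> {..<length \<alpha>}" "ks ! i = ks ! j"
    thus "i = j" using less[of i j] less[of j i] by (cases i j rule: linorder_cases) auto
  qed
  have sum_ks: "(\<Sum>k\<in>(!) ks ` J. Poly_Mapping.lookup ?m k) = (\<Sum>j\<in>J. \<alpha> ! j)"
    if "J \<subseteq> {..<length \<alpha>}" for J
  proof -
    have "inj_on ((!) ks) J" using inj that by (rule inj_on_subset)
    thus ?thesis using nth that by (subst sum.reindex) (auto intro!: sum.cong)
  qed
  show "total_degree ?m = sum_list \<alpha>"
    unfolding total_degree_def keys set_ks by (subst sum_ks) (use sumlist[of "length \<alpha>"] in auto)
  have cum: "cum ?m (ks ! j) = sum_list (take j \<alpha>)" if "j < length \<alpha>" for j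
  proof -
    have "cum ?m (ks ! j) = (\<Sum>k\<in>(!) ks ` {..<j}. Poly_Mapping.lookup ?m k)"
      unfolding cum_def
    proof (rule sum.mono_neutral_right)
      show "(!) ks ` {..<j} \<subseteq> {..<ks ! j}" using less that by auto
      show "\<forall>i\<in>{..<ks ! j} - (!) ks ` {..<j}. Poly_Mapping.lookup ?m i = 0"
      proof
        fix i assume i: "i \<in> {..<ks ! j} - (!) ks ` {..<j}"
        have "i \<notin> set ks" using i less that by (auto simp: set_ks)
        thus "Poly_Mapping.lookup ?m i = 0" by (simp add: keys[symmetric] in_keys_iff)
      qed
    qed simp
    also have "\<dots> = sum_list (take j \<alpha>)" using that by (subst sum_ks) (auto simp: sumlist)
    finally show ?thesis .
  qed
  have "cum ?m ` set ks = set (psums \<alpha>)"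
    unfolding set_ks image_image psums_def set_map
    using cum by (intro image_cong) auto
  thus "set_of_monomial ?m = set (psums \<alpha>) - {0}"
    by (simp add: set_of_monomial_def keys)
qed

text \<open>A monomial forces its list of variables, namely its keys in increasing order, and it
  forces S through its exponents. So the M_\<alpha>(S) of degree n are multiplicity-free and have
  disjoint supports.\<close>

lemma monomials_of_composition:
  assumes S: "S \<subseteq> {1..n - 1}"
  defines "\<alpha> \<equiv> composition_of_set n S"
  shows "{ks. length ks = length \<alpha> \<and> sorted_wrt (<) ks \<and> monomial_of ks \<alpha> = m} =
    (if total_degree m = n \<and> set_of_monomial m = S
     then {sorted_list_of_set (Poly_Mapping.keys m)} else {})"
proof -
  note \<alpha> = composition_of_set[OF S, folded \<alpha>_def]
  have "total_degree m = n \<and> set_of_monomial m = S \<and> ks = sorted_list_of_set (Poly_Mapping.keys m)"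
    if ks: "length ks = length \<alpha>" "sorted_wrt (<) ks" "monomial_of ks \<alpha> = m" for ks
  proof -
    note mono = monomial_of[OF ks(2,1) \<alpha>(1), unfolded ks(3)]
    have "ks = sorted_list_of_set (Poly_Mapping.keys m)"
      using ks(2) mono(1) by (intro strict_sorted_equal) auto
    thus ?thesis using mono(3,4) \<alpha>(2,3) by simp
  qed
  moreover have "length ks = length \<alpha> \<and> sorted_wrt (<) ks \<and> monomial_of ks \<alpha> = m"
    if m: "total_degree m = n" "set_of_monomial m = S"
      and ks_def: "ks = sorted_list_of_set (Poly_Mapping.keys m)" for ks
  proof -
    \<comment> \<open>The exponents of m in the order of its variables; they form \<alpha> because
      both lists have the same total and the same partial sums.\<close>
    define \<beta> where "\<beta> = map (Poly_Mapping.lookup m) ks"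
    have ks: "sorted_wrt (<) ks" "length ks = length \<beta>" "set ks = Poly_Mapping.keys m"
      by (simp_all add: ks_def \<beta>_def)
    have pos: "0 < b" if "b \<in> set \<beta>" for b using that ks by (auto simp: \<beta>_def in_keys_iff)
    note \<beta> = monomial_of[OF ks(1,2) pos]
    have eq: "monomial_of ks \<beta> = m"
    proof (rule poly_mapping_eqI)
      fix k
      show "Poly_Mapping.lookup (monomial_of ks \<beta>) k = Poly_Mapping.lookup m k"
      proof (cases "k \<in> set ks")
        case True
        then obtain j where "j < length \<beta>" "k = ks ! j" using ks(2) by (auto simp: in_set_conv_nth)
        thus ?thesis using \<beta>(2) by (simp add: \<beta>_def)
      next
        case False
        hence "k \<notin> Poly_Mapping.keys m" "k \<notin> Poly_Mapping.keys (monomial_of ks \<beta>)"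
          using ks(3) \<beta>(1) by simp_all
        thus ?thesis unfolding not_in_keys_iff_lookup_eq_zero by simp
      qed
    qed
    have "\<alpha> = \<beta>"
    proof (rule composition_eqI[OF \<alpha>(1) pos])
      show "sum_list \<alpha> = sum_list \<beta>" using \<alpha>(2) \<beta>(3) m(1) eq by simp
      show "set (psums \<alpha>) - {0} = set (psums \<beta>) - {0}" using \<alpha>(3) \<beta>(4) m(2) eq by simp
    qed
    thus ?thesis using ks eq by simp
  qed
  ultimately have "(length ks = length \<alpha> \<and> sorted_wrt (<) ks \<and> monomial_of ks \<alpha> = m) \<longleftrightarrow>
      (total_degree m = n \<and> set_of_monomial m = S) \<and> ks = sorted_list_of_set (Poly_Mapping.keys m)" for ks
    by blast
  hence "{ks. length ks = length \<alpha> \<and> sorted_wrt (<) ks \<and> monomial_of ks \<alpha> = m} =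
      {ks. (total_degree m = n \<and> set_of_monomial m = S) \<and> ks = sorted_list_of_set (Poly_Mapping.keys m)}"
    by (intro Collect_cong)
  thus ?thesis by (simp split: if_split)
qed

lemma monomial_qsym_coefficient:
  assumes S: "S \<subseteq> {1..n - 1}"
  shows "monomial_qsym (composition_of_set n S) m = of_bool (total_degree m = n \<and> set_of_monomial m = S)"
proof -
  let ?\<alpha> = "composition_of_set n S"
  have "monomial_qsym ?\<alpha> m
      = of_nat (card {ks. length ks = length ?\<alpha> \<and> sorted_wrt (<) ks \<and> monomial_of ks ?\<alpha> = m})"
    unfolding monomial_qsym_def sum_of_monomials_def monomial_of_def mem_Collect_eq conj_assoc ..
  thus ?thesis
    unfolding monomials_of_composition[OF S]
    by (cases "total_degree m = n \<and> set_of_monomial m = S") simp_all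
qed

text \<open>Putting the parts of \<alpha>(S) on the first variables gives a monomial at which the
  coefficient for S can be read off.\<close>

lemma set_of_monomial_surj:
  assumes S: "S \<subseteq> {1..n - 1}"
  shows "\<exists>m. total_degree m = n \<and> set_of_monomial m = S"
proof -
  define \<alpha> where "\<alpha> = composition_of_set n S"
  define m where "m = monomial_of [0..<length \<alpha>] \<alpha>"
  note \<alpha> = composition_of_set[OF S, folded \<alpha>_def]
  have upt: "sorted_wrt (<) [0..<length \<alpha>]" "length [0..<length \<alpha>] = length \<alpha>" by simp_all
  have "total_degree m = sum_list \<alpha>" "set_of_monomial m = set (psums \<alpha>) - {0}"
    unfolding m_def using monomial_of(3,4)[OF upt \<alpha>(1)] by blast+
  thus ?thesis unfolding \<alpha>(2,3) by blast
qed

section \<open>Colorings with prescribed block sizes\<close>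

definition relabel :: "'a set \<Rightarrow> (nat \<Rightarrow> nat) \<Rightarrow> ('a \<Rightarrow> nat) \<Rightarrow> 'a \<Rightarrow> nat" where
  "relabel N c f = (\<lambda>v\<in>N. c (f v))"

definition monomial_colorings :: "'a set \<Rightarrow> 'a set set \<Rightarrow> (nat \<Rightarrow>\<^sub>0 nat) \<Rightarrow> ('a \<Rightarrow> nat) set" where
  "monomial_colorings N E m = {f \<in> proper_colorings N E. coloring_monomial N f = m}"

text \<open>
  The ordered partitions of \<open>N\<close> into stable sets of sizes \<open>composition_of_set (card N) S\<close>: every
  block is labelled by the number of vertices in the preceding blocks, so that the labels of a
  partition are exactly the elements of \<open>insert 0 S\<close> (for nonempty \<open>N\<close>).
\<close>

definition set_colorings :: "'a set \<Rightarrow> 'a set set \<Rightarrow> nat set \<Rightarrow> ('a \<Rightarrow> nat) set" where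
  "set_colorings N E S =
     {f \<in> proper_colorings N E. f ` N \<subseteq> insert 0 S \<and> (\<forall>s\<in>S. card {v \<in> N. f v < s} = s)}"

lemma relabel_apply [simp]: "v \<in> N \<Longrightarrow> relabel N c f v = c (f v)"
  by (simp add: relabel_def)

lemma proper_coloring_outside: "f \<in> proper_colorings N E \<Longrightarrow> v \<notin> N \<Longrightarrow> f v = undefined"
  unfolding proper_colorings_def by (blast intro: PiE_arb)

lemma relabel_proper:
  assumes "f \<in> proper_colorings N E" "inj_on c (f ` N)"
  shows "relabel N c f \<in> proper_colorings N E"
  unfolding proper_colorings_def
proof (intro CollectI conjI ballI impI)
  show "relabel N c f \<in> N \<rightarrow>\<^sub>E UNIV" by (simp add: relabel_def)
  fix u v assume uv: "u \<in> N" "v \<in> N" "{u, v} \<in> E"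
  hence "f u \<noteq> f v" using assms(1) by (simp add: proper_colorings_def)
  thus "relabel N c f u \<noteq> relabel N c f v"
    using uv inj_onD[OF assms(2), of "f u" "f v"] by auto
qed

lemma proper_coloring_ext:
  assumes "f \<in> proper_colorings N E" "f' \<in> proper_colorings N E" "\<And>v. v \<in> N \<Longrightarrow> f v = f' v"
  shows "f = f'"
proof
  show "f v = f' v" for v
    using assms(3)[of v] proper_coloring_outside[OF assms(1), of v]
      proper_coloring_outside[OF assms(2), of v] by (cases "v \<in> N") simp_all
qed

lemma finite_proper_colorings:
  assumes "finite N" "finite C"
  shows "finite {f \<in> proper_colorings N E. f ` N \<subseteq> C}"
proof (rule finite_subset)
  show "{f \<in> proper_colorings N E. f ` N \<subseteq> C} \<subseteq> (N \<rightarrow>\<^sub>E C)"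
    using proper_coloring_outside by (fastforce intro: PiE_I)
  show "finite (N \<rightarrow>\<^sub>E C)" using assms by (intro finite_PiE)
qed

text \<open>Relabelling forgets which colors are used and keeps the order of the blocks. Hence all
  monomials with the same S lead to the same set of ordered partitions.\<close>

lemma relabel_monomial_colorings:
  assumes N: "finite N" and deg: "total_degree m = card N"
  shows "relabel N (cum m) ` monomial_colorings N E m = set_colorings N E (set_of_monomial m)"
    and "inj_on (relabel N (cum m)) (monomial_colorings N E m)"
proof -
  let ?K = "Poly_Mapping.keys m"
  show "inj_on (relabel N (cum m)) (monomial_colorings N E m)"
  proof (rule inj_onI)
    fix f f' assume f: "f \<in> monomial_colorings N E m" "f' \<in> monomial_colorings N E m"
      and eq: "relabel N (cum m) f = relabel N (cum m) f'"
    have keys: "f ` N = ?K" "f' ` N = ?K"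
      using f keys_coloring_monomial[OF N, of f] keys_coloring_monomial[OF N, of f']
      by (simp_all add: monomial_colorings_def)
    show "f = f'"
    proof (rule proper_coloring_ext)
      fix v assume v: "v \<in> N"
      hence "cum m (f v) = cum m (f' v)" using fun_cong[OF eq, of v] by simp
      moreover have "f v \<in> ?K" "f' v \<in> ?K" using keys v by blast+
      ultimately show "f v = f' v" by (rule inj_onD[OF inj_on_cum])
    qed (use f in \<open>auto simp: monomial_colorings_def\<close>)
  qed
  show "relabel N (cum m) ` monomial_colorings N E m = set_colorings N E (set_of_monomial m)"
  proof (intro subset_antisym subsetI)
    fix h assume "h \<in> relabel N (cum m) ` monomial_colorings N E m"
    then obtain f where f: "f \<in> proper_colorings N E" "coloring_monomial N f = m" "h = relabel N (cum m) f"
      by (auto simp: monomial_colorings_def)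
    have keys: "f ` N = ?K" using keys_coloring_monomial[OF N, of f] f(2) by simp
    have "h \<in> proper_colorings N E"
      unfolding f(3) by (rule relabel_proper[OF f(1)]) (simp add: keys inj_on_cum)
    moreover have "h ` N \<subseteq> insert 0 (set_of_monomial m)"
      using keys by (auto simp: f(3) set_of_monomial_def)
    moreover have "card {v \<in> N. h v < s} = s" if "s \<in> set_of_monomial m" for s
    proof -
      obtain k where k: "k \<in> ?K" "s = cum m k" using \<open>s \<in> _\<close> by (auto simp: set_of_monomial_def)
      have "{v \<in> N. h v < s} = {v \<in> N. f v < k}"
      proof (intro Collect_cong conj_cong refl)
        fix v assume v: "v \<in> N"
        hence "f v \<in> ?K" using keys by blast
        thus "h v < s \<longleftrightarrow> f v < k" using v by (simp add: f(3) k(2) cum_less_iff)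
      qed
      thus ?thesis using cum_coloring_monomial[OF N, of f k] f(2) k(2) by simp
    qed
    ultimately show "h \<in> set_colorings N E (set_of_monomial m)" by (simp add: set_colorings_def)
  next
    fix h assume h: "h \<in> set_colorings N E (set_of_monomial m)"
    \<comment> \<open>The delicate label is 0, which was removed from
      \<open>set_of_monomial m\<close>. It is the value at the least key, which exists because N
      contains v.\<close>
    have hK: "h v \<in> cum m ` ?K" if "v \<in> N" for v
    proof -
      have "?K \<noteq> {}" using deg that N by (auto simp: total_degree_def)
      hence "0 \<in> cum m ` ?K" by (rule zero_in_cum_keys)
      moreover have "h v \<in> insert 0 (set_of_monomial m)" using h that by (auto simp: set_colorings_def)
      ultimately show ?thesis by (auto simp: set_of_monomial_def)
    qed
    define f where "f = (\<lambda>v\<in>N. inv_into ?K (cum m) (h v))"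
    have f: "f v \<in> ?K" "cum m (f v) = h v" if "v \<in> N" for v
      using inv_into_into[OF hK[OF that]] f_inv_into_f[OF hK[OF that]] that by (simp_all add: f_def)
    have hp: "h \<in> proper_colorings N E" using h by (simp add: set_colorings_def)
    have "f \<in> proper_colorings N E"
      unfolding proper_colorings_def
    proof (intro CollectI conjI ballI impI)
      show "f \<in> N \<rightarrow>\<^sub>E UNIV" by (simp add: f_def)
      fix u v assume uv: "u \<in> N" "v \<in> N" "{u, v} \<in> E"
      hence "h u \<noteq> h v" using hp by (simp add: proper_colorings_def)
      thus "f u \<noteq> f v" using f(2)[OF uv(1)] f(2)[OF uv(2)] by auto
    qed
    moreover have "coloring_monomial N f = m"
    proof (rule poly_mapping_eqI_cum)
      fix x
      show "cum (coloring_monomial N f) x = cum m x"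
      proof (cases "\<forall>k\<in>?K. k < x")
        case True
        hence "{v \<in> N. f v < x} = N" using f by auto
        thus ?thesis using True deg by (simp add: cum_coloring_monomial[OF N] cum_eq_total_degree)
      next
        case False
        \<comment> \<open>Counts of h are prescribed at keys only, so x is moved up to the next key:
          no exponent and no value of f lies in between, and neither side changes.\<close>
        define k where "k = (LEAST k. k \<in> ?K \<and> x \<le> k)"
        have "\<exists>k. k \<in> ?K \<and> x \<le> k" using False by (meson not_less)
        hence "k \<in> ?K \<and> x \<le> k" unfolding k_def by (rule LeastI_ex)
        hence k: "k \<in> ?K" "x \<le> k" by simp_all
        have k_le: "k \<le> j" if "j \<in> ?K" "x \<le> j" for j
          unfolding k_def using that by (intro Least_le conjI)
        have "cum m k = cum m x"
          unfolding cum_def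
        proof (rule sum.mono_neutral_right)
          show "\<forall>i\<in>{..<k} - {..<x}. Poly_Mapping.lookup m i = 0"
          proof
            fix i assume i: "i \<in> {..<k} - {..<x}"
            have "i \<notin> ?K" using k_le[of i] i by auto
            thus "Poly_Mapping.lookup m i = 0" by (simp add: in_keys_iff)
          qed
        qed (use k(2) in auto)
        moreover have "{v \<in> N. f v < x} = {v \<in> N. h v < cum m k}"
        proof (intro Collect_cong conj_cong refl)
          fix v assume v: "v \<in> N"
          have "f v < x \<longleftrightarrow> f v < k" using k(2) k_le[OF f(1)[OF v]] by linarith
          also have "\<dots> \<longleftrightarrow> h v < cum m k"
            using cum_less_iff[OF f(1)[OF v], of k] f(2)[OF v] by simp
          finally show "f v < x \<longleftrightarrow> h v < cum m k" .
        qed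
        moreover have "card {v \<in> N. h v < cum m k} = cum m k"
        proof (cases "cum m k = 0")
          case False
          hence "cum m k \<in> set_of_monomial m" using k(1) by (simp add: set_of_monomial_def)
          thus ?thesis using h by (simp add: set_colorings_def)
        qed simp
        ultimately show ?thesis by (simp add: cum_coloring_monomial[OF N])
      qed
    qed
    moreover have "h = relabel N (cum m) f"
    proof
      fix v
      show "h v = relabel N (cum m) f v"
        using f(2)[of v] proper_coloring_outside[OF hp, of v] by (cases "v \<in> N") (simp_all add: relabel_def)
    qed
    ultimately show "h \<in> relabel N (cum m) ` monomial_colorings N E m"
      by (intro image_eqI[of _ _ f]) (simp_all add: monomial_colorings_def)
  qed
qed

subsection \<open>Coarsening\<close>

text \<open>Merging in terms of labels: the block labelled t ends up in the block that starts at the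
  largest admissible label not above t. Adding 0 provides the first block.\<close>

definition floor_in :: "nat set \<Rightarrow> nat \<Rightarrow> nat" where
  "floor_in S t = Max {s \<in> insert 0 S. s \<le> t}"

lemma floor_in:
  shows floor_in_mem: "floor_in S t \<in> insert 0 S"
    and floor_in_le: "floor_in S t \<le> t"
    and le_floor_in: "s \<in> insert 0 S \<Longrightarrow> s \<le> t \<Longrightarrow> s \<le> floor_in S t"
proof -
  have fin: "finite {s \<in> insert 0 S. s \<le> t}" by (rule finite_subset[of _ "{..t}"]) auto
  have "floor_in S t \<in> {s \<in> insert 0 S. s \<le> t}"
    unfolding floor_in_def by (rule Max_in[OF fin]) auto
  thus "floor_in S t \<in> insert 0 S" "floor_in S t \<le> t" by auto
  show "s \<in> insert 0 S \<Longrightarrow> s \<le> t \<Longrightarrow> s \<le> floor_in S t"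
    unfolding floor_in_def by (rule Max_ge[OF fin]) auto
qed

text \<open>Rounding down never crosses a threshold in S, so the counts that define
  \<open>set_colorings\<close> survive merging.\<close>

lemma floor_in_less_iff: "s \<in> insert 0 S \<Longrightarrow> floor_in S t < s \<longleftrightarrow> t < s"
  using floor_in_le[of S t] le_floor_in[of s S t] by linarith

lemma floor_in_eqI:
  assumes "r \<in> insert 0 S" "r \<le> t" "\<And>s. s \<in> S \<Longrightarrow> s \<le> t \<Longrightarrow> s \<le> r"
  shows "floor_in S t = r"
proof (rule antisym)
  show "floor_in S t \<le> r" using floor_in_mem[of S t] floor_in_le[of S t] assms(3) by auto
  show "r \<le> floor_in S t" by (rule le_floor_in[OF assms(1,2)])
qed

text \<open>Sorting the vertices by label, with ties broken arbitrarily, gives a linear order that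
  refines the blocks; it is the source of the splitting.\<close>

lemma compatible_enumeration:
  fixes f :: "'a \<Rightarrow> nat"
  assumes "finite N"
  shows "\<exists>e. bij_betw e N {..<card N} \<and> (\<forall>u\<in>N. \<forall>v\<in>N. f u < f v \<longrightarrow> e u < e v)"
proof -
  obtain ys where ys: "set ys = N" "distinct ys" using finite_distinct_list[OF assms] by blast
  define xs where "xs = sort_key f ys"
  have xs: "set xs = N" "distinct xs" "sorted (map f xs)" by (simp_all add: xs_def ys)
  have len: "length xs = card N" using distinct_card[OF xs(2)] xs(1) by simp
  have bij: "bij_betw ((!) xs) {..<card N} N" using xs len by (intro bij_betw_nth) auto
  define e where "e = inv_into {..<card N} ((!) xs)"
  have e: "e v < card N" "xs ! e v = v" if "v \<in> N" for v
    using bij_betw_apply[OF bij_betw_inv_into[OF bij] that] bij_betw_inv_into_right[OF bij that]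
    by (simp_all add: e_def)
  show ?thesis
  proof (intro exI[of _ e] conjI ballI impI)
    show "bij_betw e N {..<card N}" unfolding e_def by (rule bij_betw_inv_into[OF bij])
    fix u v assume uv: "u \<in> N" "v \<in> N" "f u < f v"
    show "e u < e v"
    proof (rule ccontr)
      assume "\<not> e u < e v"
      hence "map f xs ! e v \<le> map f xs ! e u"
        using xs(3) e uv len by (intro sorted_nth_mono) auto
      thus False using e uv len by simp
    qed
  qed
qed

lemma card_enumeration_less:
  assumes e: "bij_betw e N {..<n}" and "s \<le> n"
  shows "card {v \<in> N. e v < s} = s"
proof -
  have "e ` {v \<in> N. e v < s} = {..<s}"
  proof (intro subset_antisym subsetI)
    fix i assume i: "i \<in> {..<s}"
    hence "i \<in> e ` N" using e assms(2) by (auto simp: bij_betw_def)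
    thus "i \<in> e ` {v \<in> N. e v < s}" using i by auto
  qed auto
  moreover have "inj_on e {v \<in> N. e v < s}"
    by (rule inj_on_subset[OF bij_betw_imp_inj_on[OF e]]) auto
  ultimately show ?thesis using card_image[of e "{v \<in> N. e v < s}"] by simp
qed

text \<open>For a preimage of f, order the vertices compatibly with f and cut this order at the
  elements of T. Cutting refines the blocks of f, and subsets of stable sets are stable.\<close>

lemma relabel_floor_set_colorings:
  assumes N: "finite N" and ST: "S \<subseteq> T" and T: "T \<subseteq> {1..card N - 1}"
  shows "relabel N (floor_in S) ` {f \<in> set_colorings N E T. relabel N (floor_in S) f \<in> proper_colorings N E}
    = set_colorings N E S"
proof (intro subset_antisym subsetI)
  fix h assume "h \<in> relabel N (floor_in S) ` {f \<in> set_colorings N E T. relabel N (floor_in S) f \<in> proper_colorings N E}"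
  then obtain f where f: "f \<in> set_colorings N E T" "h \<in> proper_colorings N E" "h = relabel N (floor_in S) f"
    by auto
  have "card {v \<in> N. h v < s} = s" if "s \<in> S" for s
  proof -
    have "{v \<in> N. h v < s} = {v \<in> N. f v < s}"
      using that by (auto simp: f(3) floor_in_less_iff)
    moreover have "s \<in> T" using that ST by blast
    ultimately show ?thesis using f(1) by (simp add: set_colorings_def)
  qed
  thus "h \<in> set_colorings N E S"
    using f(2) floor_in_mem[of S] by (auto simp: set_colorings_def f(3))
next
  fix f assume f: "f \<in> set_colorings N E S"
  hence fp: "f \<in> proper_colorings N E" by (simp add: set_colorings_def)
  obtain e where e: "bij_betw e N {..<card N}"
    and mono: "\<And>u v. u \<in> N \<Longrightarrow> v \<in> N \<Longrightarrow> f u < f v \<Longrightarrow> e u < e v"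
    using compatible_enumeration[OF N, of f] by blast
  have le: "t \<le> card N" if "t \<in> insert 0 T" for t
    using that T by (auto dest!: subsetD)
  have less_iff: "f v < s \<longleftrightarrow> e v < s" if s: "s \<in> insert 0 S" and v: "v \<in> N" for s v
  proof -
    let ?A = "{u \<in> N. f u < s}" and ?B = "{u \<in> N. e u < s}"
    have card: "card ?A = s" "card ?B = s"
    proof -
      show "card ?A = s" using f s by (cases "s = 0") (auto simp: set_colorings_def)
      show "card ?B = s" using s ST by (intro card_enumeration_less[OF e] le) auto
    qed
    \<comment> \<open>Since e refines f, both sets are initial segments for e and hence nested;
      having s elements each, they coincide.\<close>
    have "?A \<subseteq> ?B \<or> ?B \<subseteq> ?A"
    proof (rule ccontr)
      assume "\<not> (?A \<subseteq> ?B \<or> ?B \<subseteq> ?A)"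
      then obtain a b where "a \<in> N" "b \<in> N" "f a < s" "\<not> e a < s" "e b < s" "\<not> f b < s" by blast
      thus False using mono[of a b] by simp
    qed
    moreover have "finite ?A" "finite ?B" using N by simp_all
    ultimately have "?A = ?B" using card card_subset_eq[of ?A ?B] card_subset_eq[of ?B ?A] by auto
    thus ?thesis using v by blast
  qed
  \<comment> \<open>The position of v is rounded down to T: this is the label of v after the order e
    has been cut at T.\<close>
  define f' where "f' = relabel N (floor_in T) e"
  have f'_N: "f' v = floor_in T (e v)" if "v \<in> N" for v using that by (simp add: f'_def)
  have floor: "floor_in S (f' v) = f v" if v: "v \<in> N" for v
  proof (rule floor_in_eqI)
    show fv: "f v \<in> insert 0 S" using f v by (auto simp: set_colorings_def)
    have "f v \<le> e v" using less_iff[OF fv v] by simp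
    thus "f v \<le> f' v" unfolding f'_N[OF v] using fv ST by (intro le_floor_in) auto
    fix s assume s: "s \<in> S" "s \<le> f' v"
    hence "s \<le> e v" using floor_in_le[of T "e v"] f'_N[OF v] by simp
    thus "s \<le> f v" using less_iff[of s v] s(1) v by auto
  qed
  have rel: "relabel N (floor_in S) f' = f"
  proof
    fix v
    show "relabel N (floor_in S) f' v = f v"
      using floor[of v] proper_coloring_outside[OF fp, of v]
      by (cases "v \<in> N") (simp_all add: relabel_def)
  qed
  \<comment> \<open>By \<open>floor\<close>, f is a function of \<open>f'\<close>, so
    \<open>f'\<close> separates all vertices that f separates.\<close>
  have "f' \<in> proper_colorings N E"
    unfolding proper_colorings_def
  proof (intro CollectI conjI ballI impI)
    show "f' \<in> N \<rightarrow>\<^sub>E UNIV" by (simp add: f'_def relabel_def)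
    fix u v assume uv: "u \<in> N" "v \<in> N" "{u, v} \<in> E"
    hence "f u \<noteq> f v" using fp by (auto simp: proper_colorings_def)
    thus "f' u \<noteq> f' v" using floor[OF uv(1)] floor[OF uv(2)] by auto
  qed
  moreover have "card {v \<in> N. f' v < t} = t" if "t \<in> T" for t
  proof -
    have "{v \<in> N. f' v < t} = {v \<in> N. e v < t}"
      using that by (auto simp: f'_N floor_in_less_iff)
    thus ?thesis using card_enumeration_less[OF e le] that by simp
  qed
  ultimately have "f' \<in> set_colorings N E T"
    using floor_in_mem[of T] by (auto simp: set_colorings_def f'_N)
  hence "f' \<in> {f \<in> set_colorings N E T. relabel N (floor_in S) f \<in> proper_colorings N E}"
    using rel fp by simp
  thus "f \<in> relabel N (floor_in S) ` {f \<in> set_colorings N E T. relabel N (floor_in S) f \<in> proper_colorings N E}"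
    using rel by (intro image_eqI[of _ _ f']) simp_all
qed

section \<open>The group action on colorings\<close>

locale colored_graph =
  fixes N :: "'a set" and E :: "'a set set" and H :: "('a \<Rightarrow> 'a) set"
  assumes graph: "simple_graph N E" and subgroup: "subgroup H (aut_group N E)"
begin

abbreviation "G \<equiv> (aut_group N E)\<lparr>carrier := H\<rparr>"

lemma finite_N: "finite N"
  using graph by (simp add: simple_graph_def)

lemma group_aut_group: "group (aut_group N E)"
proof (rule groupI)
  fix p assume p: "p \<in> carrier (aut_group N E)"
  hence perm: "p permutes N" by (simp add: aut_group_def)
  have "{inv_into UNIV p u, inv_into UNIV p v} \<in> E \<longleftrightarrow> {u, v} \<in> E" if "u \<in> N" "v \<in> N" for u v
  proof -
    have "inv_into UNIV p u \<in> N" "inv_into UNIV p v \<in> N" using permutes_inv[OF perm] that by (simp_all add: permutes_in_image)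
    hence "{p (inv_into UNIV p u), p (inv_into UNIV p v)} \<in> E \<longleftrightarrow> {inv_into UNIV p u, inv_into UNIV p v} \<in> E"
      using p by (auto simp: aut_group_def)
    thus ?thesis by (simp add: permutes_inverses[OF perm])
  qed
  hence "inv_into UNIV p \<in> carrier (aut_group N E)"
    by (simp add: aut_group_def permutes_inv[OF perm])
  moreover have "inv_into UNIV p \<otimes>\<^bsub>aut_group N E\<^esub> p = \<one>\<^bsub>aut_group N E\<^esub>"
    by (simp add: aut_group_def permutes_inv_o[OF perm])
  ultimately show "\<exists>q\<in>carrier (aut_group N E). q \<otimes>\<^bsub>aut_group N E\<^esub> p = \<one>\<^bsub>aut_group N E\<^esub>" by blast
qed (auto simp: aut_group_def permutes_compose permutes_id permutes_in_image o_assoc)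

lemma group_G: "group G"
  by (rule subgroup.subgroup_is_group[OF subgroup group_aut_group])

lemma permutes: "g \<in> H \<Longrightarrow> g permutes N"
  and edge_iff: "g \<in> H \<Longrightarrow> u \<in> N \<Longrightarrow> v \<in> N \<Longrightarrow> {g u, g v} \<in> E \<longleftrightarrow> {u, v} \<in> E"
  using subgroup.subset[OF subgroup] by (auto simp: aut_group_def)

lemma inv_in_N: "g \<in> H \<Longrightarrow> inv_into UNIV g v \<in> N \<longleftrightarrow> v \<in> N"
  using permutes_inv[OF permutes] by (simp add: permutes_in_image)

lemma coloring_action_apply: "coloring_action g f v = f (inv_into UNIV g v)"
  by (simp add: coloring_action_def)

lemma coloring_action_proper:
  assumes g: "g \<in> H" and f: "f \<in> proper_colorings N E"
  shows "coloring_action g f \<in> proper_colorings N E"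
  unfolding proper_colorings_def
proof (intro CollectI conjI ballI impI)
  show "coloring_action g f \<in> N \<rightarrow>\<^sub>E UNIV"
    using proper_coloring_outside[OF f] by (intro PiE_I) (simp_all add: coloring_action_apply inv_in_N[OF g])
  fix u v assume uv: "u \<in> N" "v \<in> N" "{u, v} \<in> E"
  have "{g (inv_into UNIV g u), g (inv_into UNIV g v)} \<in> E" using uv by (simp add: permutes_inverses[OF permutes[OF g]])
  hence "{inv_into UNIV g u, inv_into UNIV g v} \<in> E" using edge_iff[OF g] uv by (simp add: inv_in_N[OF g])
  thus "coloring_action g f u \<noteq> coloring_action g f v"
    using f uv by (simp add: proper_colorings_def coloring_action_apply inv_in_N[OF g])
qed

lemma coloring_action_image:
  assumes "g \<in> H"
  shows "coloring_action g f ` N = f ` N"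
proof -
  have "coloring_action g f ` N = f ` inv_into UNIV g ` N" by (auto simp: coloring_action_apply)
  thus ?thesis using permutes_image[OF permutes_inv[OF permutes[OF assms]]] by simp
qed

lemma coloring_action_coloring_monomial:
  assumes "g \<in> H"
  shows "coloring_monomial N (coloring_action g f) = coloring_monomial N f"
  unfolding coloring_monomial_def coloring_action_apply
  by (rule sum.permute[OF permutes_inv[OF permutes[OF assms]], unfolded o_def, symmetric])

lemma coloring_action_card_less:
  assumes "g \<in> H"
  shows "card {v \<in> N. coloring_action g f v < s} = card {v \<in> N. f v < s}"
  using coloring_action_coloring_monomial[OF assms, of f] by (simp flip: cum_coloring_monomial[OF finite_N])

lemma coloring_action_relabel:
  assumes "g \<in> H"
  shows "coloring_action g (relabel N c f) = relabel N c (coloring_action g f)"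
  by (auto simp: coloring_action_apply relabel_def inv_in_N[OF assms])

lemma finite_action_colorings:
  assumes X: "finite X" "X \<subseteq> proper_colorings N E"
    and closed: "\<And>g f. g \<in> H \<Longrightarrow> f \<in> X \<Longrightarrow> coloring_action g f \<in> X"
  shows "finite_action G X coloring_action"
proof (intro finite_action.intro finite_action_axioms.intro)
  fix g h f assume "g \<in> carrier G" "h \<in> carrier G"
  hence "bij g" "bij h" by (simp_all add: permutes_bij[OF permutes])
  thus "coloring_action (g \<otimes>\<^bsub>G\<^esub> h) f = coloring_action g (coloring_action h f)"
    by (simp add: coloring_action_def aut_group_def o_inv_distrib o_assoc)
qed (use X closed group_G in \<open>auto simp: coloring_action_def aut_group_def\<close>)

lemma finite_action_set_colorings:
  assumes "S \<subseteq> {1..card N - 1}"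
  shows "finite_action G (set_colorings N E S) coloring_action"
proof (rule finite_action_colorings)
  have "finite S" using assms finite_subset by blast
  thus "finite (set_colorings N E S)"
    by (intro finite_subset[OF _ finite_proper_colorings[OF finite_N, of "insert 0 S"]])
      (auto simp: set_colorings_def)
qed (auto simp: set_colorings_def coloring_action_proper coloring_action_image coloring_action_card_less)

lemma finite_action_monomial_colorings: "finite_action G (monomial_colorings N E m) coloring_action"
proof (rule finite_action_colorings)
  show "finite (monomial_colorings N E m)"
    using keys_coloring_monomial[OF finite_N]
    by (intro finite_subset[OF _ finite_proper_colorings[OF finite_N, of "Poly_Mapping.keys m"]])
      (auto simp: monomial_colorings_def)
qed (auto simp: monomial_colorings_def coloring_action_proper coloring_action_coloring_monomial)

end

section \<open>The chromatic quasisymmetric function\<close>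

lemma sum_monomial_qsym:
  "(\<Sum>S\<in>Pow {1..n - 1}. c S * monomial_qsym (composition_of_set n S) m) =
    (if total_degree m = n then c (set_of_monomial m) else 0)"
proof -
  have "(\<Sum>S\<in>Pow {1..n - 1}. c S * monomial_qsym (composition_of_set n S) m) =
      (\<Sum>S\<in>Pow {1..n - 1}. if S = set_of_monomial m then (if total_degree m = n then c S else 0) else 0)"
    by (intro sum.cong refl) (auto simp: monomial_qsym_coefficient)
  also have "\<dots> = (if total_degree m = n then c (set_of_monomial m) else 0)"
    using set_of_monomial_subset[of m] by (subst sum.delta) auto
  finally show ?thesis .
qed

context colored_graph
begin

abbreviation fixed_count :: "nat set \<Rightarrow> ('a \<Rightarrow> 'a) \<Rightarrow> complex" where
  "fixed_count S g \<equiv> of_nat (card {f \<in> set_colorings N E S. coloring_action g f = f})"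

text \<open>Relabelling is injective and commutes with the action, so it matches fixed points with
  fixed points.\<close>

lemma card_fixed_monomial_colorings:
  assumes g: "g \<in> H" and deg: "total_degree m = card N"
  shows "card {f \<in> monomial_colorings N E m. coloring_action g f = f} =
    card {f \<in> set_colorings N E (set_of_monomial m). coloring_action g f = f}"
proof (rule bij_betw_same_card)
  let ?r = "relabel N (cum m)"
  note image = relabel_monomial_colorings(1)[OF finite_N deg, of E]
  note inj = relabel_monomial_colorings(2)[OF finite_N deg, of E]
  have fixed: "coloring_action g (?r f) = ?r f \<longleftrightarrow> coloring_action g f = f"
    if f: "f \<in> monomial_colorings N E m" for f
  proof -
    have "coloring_action g f \<in> monomial_colorings N E m"
      using f g by (simp add: monomial_colorings_def coloring_action_proper coloring_action_coloring_monomial)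
    hence "?r (coloring_action g f) = ?r f \<longleftrightarrow> coloring_action g f = f"
      using f by (intro inj_on_eq_iff[OF inj])
    thus ?thesis by (simp add: coloring_action_relabel[OF g])
  qed
  show "bij_betw ?r {f \<in> monomial_colorings N E m. coloring_action g f = f}
      {f \<in> set_colorings N E (set_of_monomial m). coloring_action g f = f}"
    unfolding bij_betw_def
  proof
    show "inj_on ?r {f \<in> monomial_colorings N E m. coloring_action g f = f}"
      by (rule inj_on_subset[OF inj]) auto
    show "?r ` {f \<in> monomial_colorings N E m. coloring_action g f = f} =
        {f \<in> set_colorings N E (set_of_monomial m). coloring_action g f = f}"
      unfolding image[symmetric] using fixed by blast
  qed
qed

lemma chromatic_qsym_coefficient:
  assumes "g \<in> H"
  shows "chromatic_qsym N E g m =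
    (if total_degree m = card N then fixed_count (set_of_monomial m) g else 0)"
proof -
  have "chromatic_qsym N E g m
      = of_nat (card {f \<in> monomial_colorings N E m. coloring_action g f = f})"
    unfolding chromatic_qsym_def sum_of_monomials_def monomial_colorings_def
      coloring_monomial_def[symmetric]
    by (intro arg_cong[of _ _ of_nat] arg_cong[of _ _ card]) auto
  also have "\<dots> = (if total_degree m = card N then fixed_count (set_of_monomial m) g else 0)"
  proof (cases "total_degree m = card N")
    case False
    hence "monomial_colorings N E m = {}"
      using total_degree_coloring_monomial[OF finite_N] by (auto simp: monomial_colorings_def)
    thus ?thesis using False by simp
  qed (simp add: card_fixed_monomial_colorings[OF assms])
  finally show ?thesis .
qed

lemma qsym_expansion_fixed_count: "qsym_expansion N E H fixed_count"
  unfolding qsym_expansion_def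
proof (intro ballI ext)
  fix g m assume "g \<in> H"
  thus "chromatic_qsym N E g m = (\<Sum>S\<in>Pow {1..card N - 1}.
      fixed_count S g * monomial_qsym (composition_of_set (card N) S) m)"
    unfolding sum_monomial_qsym[of "\<lambda>S. fixed_count S g"] by (rule chromatic_qsym_coefficient)
qed

text \<open>Coefficients are compared at a single monomial of M_\<alpha>(S). This carries what is
  known about \<open>fixed_count\<close> over to an arbitrary expansion.\<close>

lemma qsym_expansion_unique:
  assumes c: "qsym_expansion N E H c" and S: "S \<subseteq> {1..card N - 1}" and g: "g \<in> H"
  shows "c S g = fixed_count S g"
proof -
  obtain m where m: "total_degree m = card N" "set_of_monomial m = S"
    using set_of_monomial_surj[OF S] by blast
  have "chromatic_qsym N E g m =
      (\<Sum>S\<in>Pow {1..card N - 1}. c S g * monomial_qsym (composition_of_set (card N) S) m)"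
    using c g by (simp add: qsym_expansion_def)
  also have "\<dots> = c S g"
    unfolding sum_monomial_qsym[of "\<lambda>S. c S g"] using m by simp
  finally show ?thesis using chromatic_qsym_coefficient[OF g, of m] m by simp
qed

text \<open>Both the inclusion of modules and the inequality of orbit numbers rest on these four
  properties. Y is invariant because p commutes with the action and the action preserves
  properness.\<close>

lemma coarsening:
  assumes "S \<subseteq> T" "T \<subseteq> {1..card N - 1}"
  defines "p \<equiv> relabel N (floor_in S)"
  defines "Y \<equiv> {f \<in> set_colorings N E T. p f \<in> proper_colorings N E}"
  shows "Y \<subseteq> set_colorings N E T"
    and "\<And>g f. g \<in> carrier G \<Longrightarrow> f \<in> Y \<Longrightarrow> coloring_action g f \<in> Y"
    and "p ` Y = set_colorings N E S"
    and "\<And>g f. g \<in> carrier G \<Longrightarrow> f \<in> Y \<Longrightarrow> p (coloring_action g f) = coloring_action g (p f)"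
proof -
  show "Y \<subseteq> set_colorings N E T" by (auto simp: Y_def)
  show "p ` Y = set_colorings N E S"
    unfolding p_def Y_def by (rule relabel_floor_set_colorings[OF finite_N assms(1,2)])
  show equiv: "p (coloring_action g f) = coloring_action g (p f)" if "g \<in> carrier G" "f \<in> Y" for g f
    using that by (simp add: p_def coloring_action_relabel)
  show "coloring_action g f \<in> Y" if gf: "g \<in> carrier G" "f \<in> Y" for g f
    using finite_action.act_closed[OF finite_action_set_colorings[OF assms(2)] gf(1), of f]
      coloring_action_proper[of g "p f"] gf equiv[OF gf]
    by (simp add: Y_def)
qed

lemma char_le_fixed_count:
  assumes c: "qsym_expansion N E H c" and ST: "S \<subseteq> T" "T \<subseteq> {1..card N - 1}"
  shows "char_le G (c S) (c T)"
proof -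
  have S: "S \<subseteq> {1..card N - 1}" using ST by blast
  define p where "p = relabel N (floor_in S)"
  define Y where "Y = {f \<in> set_colorings N E T. p f \<in> proper_colorings N E}"
  note Y = coarsening[OF ST, folded p_def, folded Y_def]
  have count: "c S g = fixed_count S g" "c T g = fixed_count T g" if "g \<in> carrier G" for g
    using that qsym_expansion_unique[OF c] S ST(2) by simp_all
  show ?thesis
    by (rule char_le_permutation_characters[where p = p and Y = Y,
          OF finite_action_set_colorings[OF S] finite_action_set_colorings[OF ST(2)] Y count])
qed

section \<open>The orbital chromatic polynomial\<close>

abbreviation orbit_count :: "nat set \<Rightarrow> nat" where
  "orbit_count S \<equiv> card (orbits G (set_colorings N E S) coloring_action)"

text \<open>The orbits on Y mediate: they map onto the orbits of type S and are themselves among the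
  orbits of type T.\<close>

lemma orbit_count_mono:
  assumes ST: "S \<subseteq> T" "T \<subseteq> {1..card N - 1}"
  shows "orbit_count S \<le> orbit_count T"
proof -
  define p where "p = relabel N (floor_in S)"
  define Y where "Y = {f \<in> set_colorings N E T. p f \<in> proper_colorings N E}"
  note Y = coarsening[OF ST, folded p_def, folded Y_def]
  note T = finite_action_set_colorings[OF ST(2)]
  have "finite_action G Y coloring_action"
    by (rule finite_action.finite_action_subset[OF T Y(1,2)])
  hence "orbit_count S \<le> card (orbits G Y coloring_action)"
    unfolding Y(3)[symmetric] by (rule card_orbits_image_le) (rule Y(4))
  also have "\<dots> \<le> orbit_count T" by (rule card_orbits_mono[OF T Y(1)])
  finally show ?thesis .
qed

lemma card_orbits_monomial_colorings:
  assumes "total_degree m = card N"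
  shows "card (orbits G (monomial_colorings N E m) coloring_action) = orbit_count (set_of_monomial m)"
  unfolding relabel_monomial_colorings(1)[OF finite_N assms, of E, symmetric]
  by (rule card_orbits_image[symmetric, OF finite_action_monomial_colorings
        relabel_monomial_colorings(2)[OF finite_N assms]])
    (simp add: coloring_action_relabel)

end

section \<open>Counting orbits of colorings with colors in [x]\<close>

lemma card_sorted_lists:
  assumes "finite A"
  shows "card {ks :: nat list. length ks = k \<and> sorted_wrt (<) ks \<and> set ks \<subseteq> A} = card A choose k"
    and "finite {ks :: nat list. length ks = k \<and> sorted_wrt (<) ks \<and> set ks \<subseteq> A}"
proof -
  let ?L = "{ks :: nat list. length ks = k \<and> sorted_wrt (<) ks \<and> set ks \<subseteq> A}"
  show "finite ?L" by (rule finite_subset[OF _ finite_lists_length_eq[OF assms, of k]]) auto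
  have "bij_betw set ?L {B. B \<subseteq> A \<and> card B = k}"
  proof (rule bij_betw_byWitness[where f' = sorted_list_of_set])
    show "\<forall>ks\<in>?L. sorted_list_of_set (set ks) = ks"
      by (auto intro: strict_sorted_equal)
    have fin: "finite B" if "B \<subseteq> A" for B using that assms by (rule finite_subset)
    show "\<forall>B\<in>{B. B \<subseteq> A \<and> card B = k}. set (sorted_list_of_set B) = B"
      using fin by simp
    show "set ` ?L \<subseteq> {B. B \<subseteq> A \<and> card B = k}"
      by (auto simp: strict_sorted_iff distinct_card)
    show "sorted_list_of_set ` {B. B \<subseteq> A \<and> card B = k} \<subseteq> ?L"
      using fin by auto
  qed
  thus "card ?L = card A choose k" using n_subsets[OF assms] by (simp add: bij_betw_same_card)
qed

context colored_graph
begin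

text \<open>The group preserves the monomial of a coloring, so orbits can be counted monomial by
  monomial. A monomial in the variables of [x] amounts to S and a choice of one color per part, and
  the number of its orbits depends on S only.\<close>

lemma orbital_count_eq:
  "orbital_count N E H x =
    (\<Sum>S\<in>Pow {1..card N - 1}. (x choose length (composition_of_set (card N) S)) * orbit_count S)"
proof -
  define \<alpha> where "\<alpha> S = composition_of_set (card N) S" for S
  define L where "L S = {ks. length ks = length (\<alpha> S) \<and> sorted_wrt (<) ks \<and> set ks \<subseteq> {1..x}}" for S
  \<comment> \<open>Monomials are indexed by pairs of S and an increasing list of colors; in this
    form the sum splits into a binomial coefficient times \<open>orbit_count S\<close>.\<close>
  define I where "I = Sigma (Pow {1..card N - 1}) L"
  define X where "X p = monomial_colorings N E (monomial_of (snd p) (\<alpha> (fst p)))" for p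
  have L: "finite (L S)" "card (L S) = x choose length (\<alpha> S)" for S
    unfolding L_def using card_sorted_lists[of "{1..x}" "length (\<alpha> S)"] by simp_all
  have mono: "total_degree (monomial_of ks (\<alpha> S)) = card N \<and> set_of_monomial (monomial_of ks (\<alpha> S)) = S \<and>
      ks = sorted_list_of_set (Poly_Mapping.keys (monomial_of ks (\<alpha> S))) \<and>
      Poly_Mapping.keys (monomial_of ks (\<alpha> S)) \<subseteq> {1..x}" if "(S, ks) \<in> I" for S ks
  proof -
    have S: "S \<subseteq> {1..card N - 1}" and ks: "length ks = length (\<alpha> S)" "sorted_wrt (<) ks" "set ks \<subseteq> {1..x}"
      using that by (auto simp: I_def L_def)
    note \<alpha> = composition_of_set[OF S, folded \<alpha>_def]
    have keys: "Poly_Mapping.keys (monomial_of ks (\<alpha> S)) = set ks"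
      and deg: "total_degree (monomial_of ks (\<alpha> S)) = card N"
      and set: "set_of_monomial (monomial_of ks (\<alpha> S)) = S"
      using monomial_of(1,3,4)[OF ks(2,1) \<alpha>(1)] \<alpha>(2,3) by simp_all
    have "ks = sorted_list_of_set (set ks)" using ks(2) by (intro strict_sorted_equal) auto
    thus ?thesis using keys deg set ks(3) by simp
  qed
  have union: "{f \<in> proper_colorings N E. f ` N \<subseteq> {1..x}} = (\<Union>p\<in>I. X p)"
  proof (intro subset_antisym subsetI)
    fix f assume "f \<in> {f \<in> proper_colorings N E. f ` N \<subseteq> {1..x}}"
    hence f: "f \<in> proper_colorings N E" "f ` N \<subseteq> {1..x}" by auto
    define m where "m = coloring_monomial N f"
    define ks where "ks = sorted_list_of_set (Poly_Mapping.keys m)"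
    define S where "S = set_of_monomial m"
    have deg: "total_degree m = card N"
      using total_degree_coloring_monomial[OF finite_N] by (simp add: m_def)
    have S: "S \<subseteq> {1..card N - 1}" using set_of_monomial_subset[of m] deg by (simp add: S_def)
    have "ks \<in> {ks. length ks = length (\<alpha> S) \<and> sorted_wrt (<) ks \<and> monomial_of ks (\<alpha> S) = m}"
      unfolding \<alpha>_def monomials_of_composition[OF S] using deg by (simp add: S_def ks_def)
    hence ks: "length ks = length (\<alpha> S)" "sorted_wrt (<) ks" "monomial_of ks (\<alpha> S) = m" by simp_all
    have "set ks \<subseteq> {1..x}"
      using f(2) keys_coloring_monomial[OF finite_N, of f] finite_N by (simp add: ks_def m_def)
    hence "(S, ks) \<in> I" using S ks by (simp add: I_def L_def)
    moreover have "f \<in> X (S, ks)" using f(1) ks(3) by (simp add: X_def monomial_colorings_def m_def)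
    ultimately show "f \<in> (\<Union>p\<in>I. X p)" by blast
  next
    fix f assume "f \<in> (\<Union>p\<in>I. X p)"
    then obtain S ks where p: "(S, ks) \<in> I" "f \<in> X (S, ks)" by auto
    have f: "f \<in> proper_colorings N E" "coloring_monomial N f = monomial_of ks (\<alpha> S)"
      using p(2) by (simp_all add: X_def monomial_colorings_def)
    have "f ` N \<subseteq> {1..x}"
      using mono[OF p(1)] keys_coloring_monomial[OF finite_N, of f] f(2) by simp
    thus "f \<in> {f \<in> proper_colorings N E. f ` N \<subseteq> {1..x}}" using f(1) by simp
  qed
  have disj: "X p \<inter> X q = {}" if pq: "p \<in> I" "q \<in> I" "p \<noteq> q" for p q
  proof (rule ccontr)
    obtain S ks T ls where p: "p = (S, ks)" and q: "q = (T, ls)" by (metis surj_pair)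
    assume "X p \<inter> X q \<noteq> {}"
    then obtain f where "f \<in> X p" "f \<in> X q" by blast
    hence eq: "monomial_of ks (\<alpha> S) = monomial_of ls (\<alpha> T)"
      by (simp add: X_def monomial_colorings_def p q)
    have "S = T" "ks = ls" using mono[of S ks] mono[of T ls] pq p q eq by simp_all
    thus False using pq(3) p q by simp
  qed
  have "orbital_count N E H x = card (orbits G (\<Union>p\<in>I. X p) coloring_action)"
    unfolding orbital_count_def union ..
  also have "\<dots> = (\<Sum>p\<in>I. card (orbits G (X p) coloring_action))"
  proof (rule card_orbits_UNION)
    show "finite I" unfolding I_def using L by (intro finite_SigmaI) auto
    show "finite_action G (X p) coloring_action" for p
      unfolding X_def by (rule finite_action_monomial_colorings)
  qed (rule disj)
  also have "\<dots> = (\<Sum>(S, ks)\<in>I. orbit_count S)"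
  proof (intro sum.cong refl, clarify)
    fix S ks assume "(S, ks) \<in> I"
    thus "card (orbits G (X (S, ks)) coloring_action) = orbit_count S"
      using mono[of S ks] card_orbits_monomial_colorings[of "monomial_of ks (\<alpha> S)"] by (simp add: X_def)
  qed
  also have "\<dots> = (\<Sum>S\<in>Pow {1..card N - 1}. \<Sum>ks\<in>L S. orbit_count S)"
    unfolding I_def using L by (subst sum.Sigma) auto
  also have "\<dots> = (\<Sum>S\<in>Pow {1..card N - 1}. (x choose length (\<alpha> S)) * orbit_count S)"
    by (simp add: L)
  finally show ?thesis by (simp add: \<alpha>_def)
qed

text \<open>Indexing by the number of parts, rather than by \<open>card S + 1\<close>, also covers
  the empty graph, whose only composition has no parts.\<close>

definition orbital_coeff :: "nat \<Rightarrow> nat" where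
  "orbital_coeff i =
     (\<Sum>S\<in>{S \<in> Pow {1..card N - 1}. length (composition_of_set (card N) S) = i}. orbit_count S)"

lemma orbital_count_orbital_coeff:
  "orbital_count N E H x = (\<Sum>i\<le>card N. orbital_coeff i * (x choose i))"
proof -
  let ?P = "Pow {1..card N - 1}" and ?l = "\<lambda>S. length (composition_of_set (card N) S)"
  have l: "?l ` ?P \<subseteq> {..card N}"
  proof (intro image_subsetI)
    fix S assume "S \<in> ?P"
    hence S: "S \<subseteq> {1..card N - 1}" by simp
    hence "card S \<le> card N - 1" using card_mono[OF finite_atLeastAtMost S] by simp
    moreover have "finite S" using S finite_subset by blast
    ultimately show "?l S \<in> {..card N}" by (auto simp: length_composition_of_set)
  qed
  have "orbital_count N E H x = (\<Sum>S\<in>?P. (x choose ?l S) * orbit_count S)"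
    by (rule orbital_count_eq)
  also have "\<dots> = (\<Sum>i\<le>card N. \<Sum>S\<in>{S \<in> ?P. ?l S = i}. (x choose ?l S) * orbit_count S)"
    by (rule sum.group[symmetric]) (use l in auto)
  also have "\<dots> = (\<Sum>i\<le>card N. orbital_coeff i * (x choose i))"
    by (intro sum.cong refl) (simp add: orbital_coeff_def sum_distrib_left sum_distrib_right mult.commute)
  finally show ?thesis .
qed

end

section \<open>Double counting and the inequality between consecutive coefficients\<close>

text \<open>Pairs (S, x) with x outside S correspond to pairs (T, x) with x in T through T =
  \<open>insert x S\<close>. Each S of size k occurs \<open>card A - k\<close> times and each T
  occurs k + 1 times. For k below \<open>card A\<close> this says that the average of a monotone a
  over the k-subsets is at most its average over the (k+1)-subsets.\<close>

lemma sum_subsets_insert_le: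
  fixes a :: "'s set \<Rightarrow> real"
  assumes A: "finite A" and mono: "\<And>S T. S \<subseteq> T \<Longrightarrow> T \<subseteq> A \<Longrightarrow> a S \<le> a T"
  shows "(real (card A) - real k) * (\<Sum>S\<in>{S. S \<subseteq> A \<and> card S = k}. a S)
    \<le> real (Suc k) * (\<Sum>T\<in>{T. T \<subseteq> A \<and> card T = Suc k}. a T)"
proof -
  let ?P = "\<lambda>k. {S. S \<subseteq> A \<and> card S = k}"
  have fin: "finite S" if "S \<subseteq> A" for S using that A by (rule finite_subset)
  have finP: "finite (?P j)" for j using A by simp
  have "(real (card A) - real k) * (\<Sum>S\<in>?P k. a S) = (\<Sum>S\<in>?P k. \<Sum>x\<in>A - S. a S)"
    unfolding sum_distrib_left
  proof (intro sum.cong refl)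
    fix S assume S: "S \<in> ?P k"
    hence "card (A - S) = card A - k" "k \<le> card A"
      using fin A card_Diff_subset[of S A] card_mono[of A S] by auto
    thus "(real (card A) - real k) * a S = (\<Sum>x\<in>A - S. a S)" by simp
  qed
  also have "\<dots> \<le> (\<Sum>S\<in>?P k. \<Sum>x\<in>A - S. a (insert x S))"
    by (intro sum_mono mono) auto
  also have "\<dots> = (\<Sum>(S, x)\<in>Sigma (?P k) (\<lambda>S. A - S). a (insert x S))"
    using A finP by (intro sum.Sigma) auto
  also have "\<dots> = (\<Sum>(T, x)\<in>Sigma (?P (Suc k)) (\<lambda>T. T). a T)"
  proof (rule sum.reindex_bij_witness[where j = "\<lambda>(S, x). (insert x S, x)"
        and i = "\<lambda>(T, x). (T - {x}, x)"], goal_cases)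
    case (2 p)
    then obtain S x where "p = (S, x)" "S \<subseteq> A" "card S = k" "x \<in> A" "x \<notin> S" by auto
    thus ?case using fin[of S] by simp
  next
    case (4 p)
    then obtain T x where "p = (T, x)" "T \<subseteq> A" "card T = Suc k" "x \<in> T" by auto
    thus ?case using fin[of T] by auto
  qed auto
  also have "\<dots> = (\<Sum>T\<in>?P (Suc k). \<Sum>x\<in>T. a T)"
    using fin finP by (intro sum.Sigma[symmetric]) auto
  also have "\<dots> = real (Suc k) * (\<Sum>T\<in>?P (Suc k). a T)"
    unfolding sum_distrib_left by (intro sum.cong refl) simp
  finally show ?thesis .
qed

context colored_graph
begin

lemma orbital_coeff_step:
  assumes "i < card N"
  shows "(real (card N) - real i) * real (orbital_coeff i) \<le> real i * real (orbital_coeff (i + 1))"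
proof -
  let ?A = "{1..card N - 1}"
  have pos: "0 < card N" using assms by simp
  have coeff: "{S \<in> Pow ?A. length (composition_of_set (card N) S) = j}
      = {S. S \<subseteq> ?A \<and> Suc (card S) = j}" for j
  proof (intro Collect_cong)
    fix S
    show "S \<in> Pow ?A \<and> length (composition_of_set (card N) S) = j \<longleftrightarrow> S \<subseteq> ?A \<and> Suc (card S) = j"
      using pos finite_subset[of S ?A] by (auto simp: length_composition_of_set)
  qed
  show ?thesis
  proof (cases i)
    case 0
    \<comment> \<open>A nonempty N has no composition without parts, so the coefficient at 0
      vanishes.\<close>
    thus ?thesis unfolding orbital_coeff_def coeff by simp
  next
    case (Suc k)
    have "(real (card ?A) - real k) * (\<Sum>S\<in>{S. S \<subseteq> ?A \<and> card S = k}. real (orbit_count S))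
        \<le> real (Suc k) * (\<Sum>T\<in>{T. T \<subseteq> ?A \<and> card T = Suc k}. real (orbit_count T))"
      by (rule sum_subsets_insert_le) (use orbit_count_mono in auto)
    \<comment> \<open>Two shifts cancel: the ground set has n - 1 elements, and i parts come from i
      - 1 cuts.\<close>
    moreover have "real (card ?A) - real k = real (card N) - real i" using pos Suc by simp
    ultimately have "(real (card N) - real i) * (\<Sum>S\<in>{S. S \<subseteq> ?A \<and> card S = k}. real (orbit_count S))
        \<le> real i * (\<Sum>T\<in>{T. T \<subseteq> ?A \<and> card T = Suc k}. real (orbit_count T))"
      by (simp only: Suc)
    thus ?thesis
      unfolding orbital_coeff_def coeff by (simp only: Suc Suc_eq_plus1[symmetric] nat.inject of_nat_sum)
  qed
qed

end

section \<open>The binomial basis and the arithmetic of the coefficients\<close>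

text \<open>The system is unitriangular: at x = i the terms with index above i vanish and the term
  with index i has binomial coefficient 1.\<close>

lemma binomial_coefficients_unique:
  fixes f g :: "nat \<Rightarrow> real"
  assumes eq: "\<And>x::nat. (\<Sum>i\<le>n. f i * (real x gchoose i)) = (\<Sum>i\<le>n. g i * (real x gchoose i))"
    and "i \<le> n"
  shows "f i = g i"
  using \<open>i \<le> n\<close>
proof (induction i rule: less_induct)
  case (less i)
  have split: "(\<Sum>j\<le>n. h j * (real i gchoose j)) = (\<Sum>j<i. h j * (real i gchoose j)) + h i"
    for h :: "nat \<Rightarrow> real"
  proof -
    have "(\<Sum>j\<le>n. h j * (real i gchoose j)) = (\<Sum>j\<le>i. h j * (real i gchoose j))"
      using less.prems by (intro sum.mono_neutral_right) (auto simp: binomial_gbinomial[symmetric])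
    also have "\<dots> = (\<Sum>j<i. h j * (real i gchoose j)) + h i * (real i gchoose i)"
      by (simp add: lessThan_Suc_atMost[symmetric])
    also have "real i gchoose i = 1" by (simp flip: binomial_gbinomial)
    finally show ?thesis by simp
  qed
  have "(\<Sum>j<i. f j * (real i gchoose j)) = (\<Sum>j<i. g j * (real i gchoose j))"
    using less by (intro sum.cong) auto
  thus ?case using eq[of i] by (simp add: split)
qed

text \<open>The description in \<open>orbital_chromatic_poly\<close> ranges over polynomials, so the
  binomial basis has to be available as polynomials and not only as functions.\<close>

definition gbinomial_poly :: "nat \<Rightarrow> real poly" where
  "gbinomial_poly i = Polynomial.smult (inverse (fact i)) (\<Prod>j<i. [:- of_nat j, 1:])"

lemma poly_gbinomial_poly: "poly (gbinomial_poly i) x = x gchoose i"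
  by (simp add: gbinomial_poly_def poly_prod gbinomial_prod_rev field_simps atLeast0LessThan)

text \<open>A difference with infinitely many roots is zero; this yields the uniqueness behind the
  definite description of \<open>orbital_chromatic_poly\<close>.\<close>

lemma poly_eqI_nat:
  fixes p q :: "real poly"
  assumes "\<And>x::nat. poly p (real x) = poly q (real x)"
  shows "p = q"
proof (rule ccontr)
  assume "p \<noteq> q"
  hence "finite {x. poly (p - q) x = 0}" by (intro poly_roots_finite) simp
  moreover have "range real \<subseteq> {x. poly (p - q) x = 0}" using assms by auto
  ultimately have "finite (range real)" by (rule finite_subset[rotated])
  thus False using finite_imageD[of real UNIV] by (simp add: inj_on_def)
qed

text \<open>The symmetric inequality is proved from the middle outwards: the one for the inner pair
  i + 1, n - i - 1 is combined with \<open>step\<close> at i and at n - i - 1.\<close>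

lemma coefficients_symmetric_le:
  fixes f :: "nat \<Rightarrow> real"
  assumes nonneg: "\<And>i. i \<le> n \<Longrightarrow> 0 \<le> f i"
    and step: "\<And>i. i < n \<Longrightarrow> (real n - real i) * f i \<le> real i * f (i + 1)"
  shows "2 * i < n \<Longrightarrow> f i \<le> f (i + 1)" and "2 * i \<le> n \<Longrightarrow> f i \<le> f (n - i)"
proof -
  show mono: "f i \<le> f (i + 1)" if i: "2 * i < n" for i
  proof -
    have "(real n - real i) * f i \<le> real i * f (i + 1)" using i by (intro step) simp
    \<comment> \<open>Below the middle i \<le> n - i, and \<open>f (i + 1)\<close> is nonnegative;
      the common factor n - i is positive and cancels.\<close>
    also have "\<dots> \<le> (real n - real i) * f (i + 1)"
      using i nonneg[of "i + 1"] by (intro mult_right_mono) auto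
    finally show ?thesis using i by simp
  qed
  show "f i \<le> f (n - i)" if "2 * i \<le> n" for i
    using that
  proof (induction "n - 2 * i" arbitrary: i rule: less_induct)
    case less
    consider "n = 2 * i" | "n = 2 * i + 1" | "2 * i + 2 \<le> n" using less.prems by linarith
    thus ?case
    proof cases
      case 2
      thus ?thesis using mono[of i] by simp
    next
      case 3
      \<comment> \<open>The mirror image of i + 1. The factor n - j of \<open>step\<close> at j is i
        + 1, which is why the chain starts by multiplying with i + 1.\<close>
      define j where "j = n - i - 1"
      have j: "j < n" "real j = real n - real i - 1" "j + 1 = n - i" "j = n - (i + 1)"
        using 3 by (auto simp: j_def of_nat_diff)
      have IH: "f (i + 1) \<le> f j" unfolding j(4) using 3 by (intro less.hyps) auto
      have "(real n - real i) * (real i + 1) * f i \<le> (real i + 1) * (real i * f (i + 1))"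
        using mult_left_mono[OF step[of i], of "real i + 1"] 3 by (simp add: mult_ac)
      also have "\<dots> \<le> (real i + 1) * (real i * f j)"
        using IH by (intro mult_left_mono) auto
      also have "\<dots> = real i * ((real n - real j) * f j)" by (simp add: j(2) mult_ac)
      also have "\<dots> \<le> real i * (real j * f (n - i))"
        using step[OF j(1), unfolded j(3)] by (intro mult_left_mono) simp_all
      also have "\<dots> \<le> (real n - real i) * (real i + 1) * f (n - i)"
      proof -
        \<comment> \<open>The right side exceeds the left by exactly n.\<close>
        have "real i * real j \<le> (real n - real i) * (real i + 1)"
          by (simp add: j(2) algebra_simps)
        hence "real i * real j * f (n - i) \<le> (real n - real i) * (real i + 1) * f (n - i)"
          using nonneg[of "n - i"] by (intro mult_right_mono) auto
        thus ?thesis by (simp add: mult_ac)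
      qed
      finally show ?thesis using 3 by simp
    qed simp
  qed
qed

theorem theorem1:
  fixes N :: "'a set" and E :: "'a set set" and H :: "('a \<Rightarrow> 'a) set"
  assumes "simple_graph N E"
    and "subgroup H (aut_group N E)"
  defines "G \<equiv> (aut_group N E)\<lparr>carrier := H\<rparr>"
    and "n \<equiv> card N"
  shows "(\<exists>c. qsym_expansion N E H c \<and> (\<forall>S\<subseteq>{1..n - 1}. class_function G (c S))) \<and>
    (\<forall>c. qsym_expansion N E H c \<and> (\<forall>S\<subseteq>{1..n - 1}. class_function G (c S)) \<longrightarrow>
      (\<forall>S\<subseteq>{1..n - 1}. is_character G (c S)) \<and>
      (\<forall>S T. S \<subseteq> T \<and> T \<subseteq> {1..n - 1} \<longrightarrow> char_le G (c S) (c T))) \<and>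
    (\<forall>x::nat. poly (orbital_chromatic_poly N E H) (real x) = real (orbital_count N E H x)) \<and>
    (\<exists>f. binomial_expansion n (orbital_chromatic_poly N E H) f) \<and>
    (\<forall>f. binomial_expansion n (orbital_chromatic_poly N E H) f \<longrightarrow>
      (\<forall>i::nat. real i \<le> (real n - 1) / 2 \<longrightarrow> f i \<le> f (i + 1)) \<and>
      (\<forall>i::nat. real i \<le> real n / 2 \<longrightarrow> f i \<le> f (n - i)) \<and>
      (\<forall>i<n. (real n - real i) * f i \<le> real i * f (i + 1)))"
proof -
  interpret colored_graph N E H by (rule colored_graph.intro) (fact assms(1,2))+
  define p where "p = (\<Sum>i\<le>n. Polynomial.smult (real (orbital_coeff i)) (gbinomial_poly i))"
  have poly_p: "poly p x = (\<Sum>i\<le>n. real (orbital_coeff i) * (x gchoose i))" for x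
    by (simp add: p_def poly_sum poly_gbinomial_poly)
  have p_nat: "poly p (real x) = real (orbital_count N E H x)" for x
    unfolding poly_p orbital_count_orbital_coeff n_def by (simp add: binomial_gbinomial)
  have p: "orbital_chromatic_poly N E H = p"
    unfolding orbital_chromatic_poly_def
    by (rule the_equality) (simp_all add: p_nat poly_eqI_nat)
  have "class_function G (fixed_count S)" if "S \<subseteq> {1..n - 1}" for S
    unfolding G_def using finite_action_set_colorings that
    by (intro finite_action.class_function_permutation_character) (simp add: n_def)
  hence expansion: "\<exists>c. qsym_expansion N E H c \<and> (\<forall>S\<subseteq>{1..n - 1}. class_function G (c S))"
    using qsym_expansion_fixed_count by (intro exI[of _ fixed_count]) simp
  have character: "is_character G (c S)" if c: "qsym_expansion N E H c" and S: "S \<subseteq> {1..n - 1}" for c S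
  proof -
    have "c S g = fixed_count S g" if "g \<in> carrier (aut_group N E\<lparr>carrier := H\<rparr>)" for g
      using that qsym_expansion_unique[OF c] S by (simp add: n_def)
    thus ?thesis
      unfolding G_def
      by (rule is_character_permutation_character[OF finite_action_set_colorings[OF S[unfolded n_def]]])
  qed
  have char_le: "char_le G (c S) (c T)"
    if "qsym_expansion N E H c" "S \<subseteq> T" "T \<subseteq> {1..n - 1}" for c S T
    using char_le_fixed_count that by (simp add: G_def n_def)
  have count: "poly (orbital_chromatic_poly N E H) (real x) = real (orbital_count N E H x)" for x
    by (simp add: p p_nat)
  have binomial: "binomial_expansion n (orbital_chromatic_poly N E H) (\<lambda>i. real (orbital_coeff i))"
    by (simp add: binomial_expansion_def p poly_p)
  have coefficients: "(real i \<le> (real n - 1) / 2 \<longrightarrow> f i \<le> f (i + 1)) \<and>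
      (real i \<le> real n / 2 \<longrightarrow> f i \<le> f (n - i)) \<and>
      (i < n \<longrightarrow> (real n - real i) * f i \<le> real i * f (i + 1))"
    if f: "binomial_expansion n (orbital_chromatic_poly N E H) f" for f i
  proof -
    have coeff: "f j = real (orbital_coeff j)" if "j \<le> n" for j
      using f that
      by (intro binomial_coefficients_unique[where f = f and g = "\<lambda>j. real (orbital_coeff j)" and n = n])
        (simp_all add: binomial_expansion_def p poly_p)
    have nonneg: "0 \<le> f j" if "j \<le> n" for j using coeff[OF that] by simp
    have step: "(real n - real j) * f j \<le> real j * f (j + 1)" if "j < n" for j
      using orbital_coeff_step[of j] that by (simp add: coeff n_def)
    have le: "f i \<le> f (i + 1)" if "2 * i < n"
      using nonneg step that by (rule coefficients_symmetric_le(1))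
    have le_sym: "f i \<le> f (n - i)" if "2 * i \<le> n"
      using nonneg step that by (rule coefficients_symmetric_le(2))
    \<comment> \<open>The bound is a real number: for n = 0 it is negative and no i satisfies
      it.\<close>
    have lt: "2 * i < n" if "real i \<le> (real n - 1) / 2"
    proof -
      have "2 * real i < real n" using that by (simp add: field_simps)
      thus ?thesis by (simp flip: of_nat_less_iff[where 'a = real])
    qed
    have leq: "2 * i \<le> n" if "real i \<le> real n / 2"
    proof -
      have "2 * real i \<le> real n" using that by (simp add: field_simps)
      thus ?thesis by (simp flip: of_nat_le_iff[where 'a = real])
    qed
    show ?thesis by (intro conjI impI le[OF lt] le_sym[OF leq] step)
  qed
  show ?thesis
  proof (intro conjI allI impI)
    show "\<exists>c. qsym_expansion N E H c \<and> (\<forall>S\<subseteq>{1..n - 1}. class_function G (c S))" by (fact expansion)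
    show "\<exists>f. binomial_expansion n (orbital_chromatic_poly N E H) f" by (rule exI) (fact binomial)
    show "poly (orbital_chromatic_poly N E H) (real x) = real (orbital_count N E H x)" for x
      by (fact count)
  next
    fix c S
    assume "qsym_expansion N E H c \<and> (\<forall>S\<subseteq>{1..n - 1}. class_function G (c S))" "S \<subseteq> {1..n - 1}"
    thus "is_character G (c S)" by (elim conjE) (rule character)
  next
    fix c S T
    assume "qsym_expansion N E H c \<and> (\<forall>S\<subseteq>{1..n - 1}. class_function G (c S))"
      "S \<subseteq> T \<and> T \<subseteq> {1..n - 1}"
    thus "char_le G (c S) (c T)" by (elim conjE) (rule char_le)
  next
    fix f i assume f: "binomial_expansion n (orbital_chromatic_poly N E H) f"
    note i = coefficients[OF f, of i]
    show "f i \<le> f (i + 1)" if "real i \<le> (real n - 1) / 2" using i that by simp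
    show "f i \<le> f (n - i)" if "real i \<le> real n / 2" using i that by simp
    show "(real n - real i) * f i \<le> real i * f (i + 1)" if "i < n" using i that by simp
  qed
qed

end
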